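(* Let $\mathcal H$ be a finite-dimensional Hilbert space and $\mathcal A\subset\mathcal O(\mathcal H)$ a set of observables. The following are equivalent: (1) $\mathcal A$ does not allow for a proof of contextuality of quantum theory; (2) $(\mathcal S(\mathcal H),\mathcal A,\mathcal A)$ is broadcastable; (3) there is a single POVM $\{G_\lambda\}_\lambda$ with $\|G_\lambda\|=1$ for all $\lambda$ such that every $\{A_k\}_k\in\mathcal A$ is a classical post-processing of $\{G_\lambda\}_\lambda$; (4) there is a single repeatable POVM such that every $\{A_k\}_k\in\mathcal A$ is a classical post-processing of it.
   Context: $\mathcal S(\mathcal H)$ is the set of states; $\mathcal O(\mathcal H)$ the set of POVMs (finitely many positive operators summing to $I$). A set of observables $\mathcal A$ does not allow for a proof of contextuality of quantum theory if there exist a POVM $\{G_\lambda\}_\lambda$ and states $\{\sigma_\lambda\}_\lambda$ (finite index set) with $\mathrm{tr}[\rho A_k]=\sum_\lambda\mathrm{tr}[\rho G_\lambda]\mathrm{tr}[\sigma_\lambda A_k]$ for all states $\rho$, all $\{A_k\}\in\mathcal A$ and all $k$; equivalently $A_k=\sum_\lambda\mathrm{tr}[\sigma_\lambda A_k]G_\lambda$. $(\mathcal T,\mathcal A,\mathcal B)$ is broadcastable if there is a CPTP map $\Lambda:\mathcal L(\mathcal H)\to\mathcal L(\mathcal H\otimes\mathcal H)$ with $\mathrm{tr}[A_k\mathrm{tr}_2\Lambda(\rho)]=\mathrm{tr}[A_k\rho]$ and $\mathrm{tr}[B_k\mathrm{tr}_1\Lambda(\rho)]=\mathrm{tr}[B_k\rho]$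 for all $\{A_k\}\in\mathcal A$, $\{B_k\}\in\mathcal B$, $\rho\in\mathcal T$, $k$. $\|\cdot\|$ is the operator norm. A classical post-processing of $\{G_\lambda\}$ is a POVM $A_k=\sum_\lambda p(k|\lambda)G_\lambda$ with $p(\cdot|\lambda)$ probability distributions. An instrument is a family $\{\mathcal I_k\}$ of completely positive trace-non-increasing maps with $\sum_k\mathcal I_k$ trace preserving; it implements $\{A_k\}$ if $\mathcal I_k^*(I)=A_k$ (Heisenberg picture). $\{A_k\}$ is repeatable if some instrument implementing it satisfies $\mathcal I_k^*(A_k)=A_k$ for all $k$. *)

theory Defs
  imports Complex_Main "Jordan_Normal_Form.Matrix"
begin

text \<open>The Hilbert space H is C^d (d > 0); operators on H are complex d x d matrices
  (Jordan_Normal_Form matrices in carrier_mat d d).  H tensor H is C^(d*d) with the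
  basis vector e_i tensor e_j at index i*d+j.  A POVM (observable) is a finite list of
  operators; its outcomes are the list positions.\<close>

definition mtrace :: "complex mat \<Rightarrow> complex" where
  "mtrace A = (\<Sum>i<dim_row A. A $$ (i, i))"

definition positive_op :: "nat \<Rightarrow> complex mat \<Rightarrow> bool" where
  "positive_op n A \<longleftrightarrow> A \<in> carrier_mat n n \<and>
     (\<forall>v :: nat \<Rightarrow> complex.
        let q = (\<Sum>i<n. \<Sum>j<n. cnj (v i) * A $$ (i, j) * v j) in Im q = 0 \<and> 0 \<le> Re q)"

definition states :: "nat \<Rightarrow> complex mat set" where
  "states d = {\<rho>. positive_op d \<rho> \<and> mtrace \<rho> = 1}"

definition msum :: "nat \<Rightarrow> ('i \<Rightarrow> complex mat) \<Rightarrow> 'i set \<Rightarrow> complex mat" where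
  "msum d f S = mat d d (\<lambda>(i, j). \<Sum>l\<in>S. f l $$ (i, j))"

definition povm :: "nat \<Rightarrow> complex mat list \<Rightarrow> bool" where
  "povm d A \<longleftrightarrow> (\<forall>k<length A. positive_op d (A ! k)) \<and>
     msum d (\<lambda>k. A ! k) {..<length A} = 1\<^sub>m d"

definition op_norm :: "nat \<Rightarrow> complex mat \<Rightarrow> real" where
  "op_norm d A = Sup {sqrt (\<Sum>i<d. (cmod (\<Sum>j<d. A $$ (i, j) * v j))\<^sup>2) | v :: nat \<Rightarrow> complex.
                        (\<Sum>j<d. (cmod (v j))\<^sup>2) \<le> 1}"

definition no_contextuality_proof :: "nat \<Rightarrow> complex mat list set \<Rightarrow> bool" where
  "no_contextuality_proof d \<A> \<longleftrightarrow>
     (\<exists>G \<sigma>. povm d G \<and> length \<sigma> = length G \<and> (\<forall>l<length \<sigma>. \<sigma> ! l \<in> states d) \<and>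
        (\<forall>\<rho>\<in>states d. \<forall>A\<in>\<A>. \<forall>k<length A.
           mtrace (\<rho> * A ! k) =
             (\<Sum>l<length G. mtrace (\<rho> * G ! l) * mtrace (\<sigma> ! l * A ! k))))"

definition linear_map :: "nat \<Rightarrow> nat \<Rightarrow> (complex mat \<Rightarrow> complex mat) \<Rightarrow> bool" where
  "linear_map n m \<Lambda> \<longleftrightarrow>
     (\<forall>X\<in>carrier_mat n n. \<Lambda> X \<in> carrier_mat m m) \<and>
     (\<forall>X\<in>carrier_mat n n. \<forall>Y\<in>carrier_mat n n. \<Lambda> (X + Y) = \<Lambda> X + \<Lambda> Y) \<and>
     (\<forall>X\<in>carrier_mat n n. \<forall>c. \<Lambda> (c \<cdot>\<^sub>m X) = c \<cdot>\<^sub>m \<Lambda> X)"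

text \<open>Ampliation id_k tensor \<Lambda>: L(C^k tensor C^n) \<rightarrow> L(C^k tensor C^m), ancilla first
  (index a*n+i).\<close>
definition ampliation :: "nat \<Rightarrow> nat \<Rightarrow> nat \<Rightarrow> (complex mat \<Rightarrow> complex mat) \<Rightarrow> complex mat \<Rightarrow> complex mat" where
  "ampliation k n m \<Lambda> X = mat (k * m) (k * m) (\<lambda>(r, s).
      \<Lambda> (mat n n (\<lambda>(i, j). X $$ ((r div m) * n + i, (s div m) * n + j))) $$ (r mod m, s mod m))"

definition completely_positive :: "nat \<Rightarrow> nat \<Rightarrow> (complex mat \<Rightarrow> complex mat) \<Rightarrow> bool" where
  "completely_positive n m \<Lambda> \<longleftrightarrow> linear_map n m \<Lambda> \<and>
     (\<forall>k X. positive_op (k * n) X \<longrightarrow> positive_op (k * m) (ampliation k n m \<Lambda> X))"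

definition trace_preserving :: "nat \<Rightarrow> (complex mat \<Rightarrow> complex mat) \<Rightarrow> bool" where
  "trace_preserving n \<Lambda> \<longleftrightarrow> (\<forall>X\<in>carrier_mat n n. mtrace (\<Lambda> X) = mtrace X)"

definition cptp :: "nat \<Rightarrow> nat \<Rightarrow> (complex mat \<Rightarrow> complex mat) \<Rightarrow> bool" where
  "cptp n m \<Lambda> \<longleftrightarrow> completely_positive n m \<Lambda> \<and> trace_preserving n \<Lambda>"

definition ptrace2 :: "nat \<Rightarrow> complex mat \<Rightarrow> complex mat" where
  "ptrace2 d Y = mat d d (\<lambda>(i, i'). \<Sum>j<d. Y $$ (i * d + j, i' * d + j))"

definition ptrace1 :: "nat \<Rightarrow> complex mat \<Rightarrow> complex mat" where
  "ptrace1 d Y = mat d d (\<lambda>(j, j'). \<Sum>i<d. Y $$ (i * d + j, i * d + j'))"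

definition broadcastable ::
  "nat \<Rightarrow> complex mat set \<Rightarrow> complex mat list set \<Rightarrow> complex mat list set \<Rightarrow> bool" where
  "broadcastable d \<T> \<A> \<B> \<longleftrightarrow>
     (\<exists>\<Lambda>. cptp d (d * d) \<Lambda> \<and>
        (\<forall>A\<in>\<A>. \<forall>k<length A. \<forall>\<rho>\<in>\<T>.
            mtrace (A ! k * ptrace2 d (\<Lambda> \<rho>)) = mtrace (A ! k * \<rho>)) \<and>
        (\<forall>B\<in>\<B>. \<forall>k<length B. \<forall>\<rho>\<in>\<T>.
            mtrace (B ! k * ptrace1 d (\<Lambda> \<rho>)) = mtrace (B ! k * \<rho>)))"

definition post_processing :: "nat \<Rightarrow> complex mat list \<Rightarrow> complex mat list \<Rightarrow> bool" where
  "post_processing d A G \<longleftrightarrow>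
     (\<exists>p :: nat \<Rightarrow> nat \<Rightarrow> real.
        (\<forall>l<length G. (\<forall>k<length A. 0 \<le> p k l) \<and> (\<Sum>k<length A. p k l) = 1) \<and>
        (\<forall>k<length A. A ! k = msum d (\<lambda>l. complex_of_real (p k l) \<cdot>\<^sub>m G ! l) {..<length G}))"

text \<open>Heisenberg-picture dual of a map on L(C^d) with respect to the pairing tr(X Y):
  tr(\<I>*(X) \<rho>) = tr(X \<I>(\<rho>)).\<close>
definition matrix_unit :: "nat \<Rightarrow> nat \<Rightarrow> nat \<Rightarrow> complex mat" where
  "matrix_unit d a b = mat d d (\<lambda>(i, j). if i = a \<and> j = b then 1 else 0)"

definition heisenberg :: "nat \<Rightarrow> (complex mat \<Rightarrow> complex mat) \<Rightarrow> complex mat \<Rightarrow> complex mat" where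
  "heisenberg d \<I> X = mat d d (\<lambda>(i, j). mtrace (X * \<I> (matrix_unit d j i)))"

definition instrument :: "nat \<Rightarrow> (complex mat \<Rightarrow> complex mat) list \<Rightarrow> bool" where
  "instrument d \<I> \<longleftrightarrow>
     (\<forall>k<length \<I>. completely_positive d d (\<I> ! k) \<and>
        (\<forall>\<rho>. positive_op d \<rho> \<longrightarrow> Re (mtrace ((\<I> ! k) \<rho>)) \<le> Re (mtrace \<rho>))) \<and>
     trace_preserving d (\<lambda>X. msum d (\<lambda>k. (\<I> ! k) X) {..<length \<I>})"

definition implements :: "nat \<Rightarrow> (complex mat \<Rightarrow> complex mat) list \<Rightarrow> complex mat list \<Rightarrow> bool" where
  "implements d \<I> A \<longleftrightarrow> instrument d \<I> \<and> length \<I> = length A \<and>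
     (\<forall>k<length A. heisenberg d (\<I> ! k) (1\<^sub>m d) = A ! k)"

definition repeatable :: "nat \<Rightarrow> complex mat list \<Rightarrow> bool" where
  "repeatable d A \<longleftrightarrow>
     (\<exists>\<I>. implements d \<I> A \<and> (\<forall>k<length A. heisenberg d (\<I> ! k) (A ! k) = A ! k))"

end

theory Submission
  imports Defs "HOL-Analysis.Function_Topology" "HOL-Library.Complex_Order"
    "HOL-Library.Function_Algebras"
begin

text \<open>
  The implications (1) to (2), (3) to (4) and (4) to (1) use measure-and-prepare channels
  \<open>X \<mapsto> \<Sum>\<^sub>l tr(G\<^sub>l X) \<tau>\<^sub>l\<close>. If \<open>\<parallel>G\<^sub>l\<parallel> = 1\<close>, a unit vector with expectation 1 under \<open>G\<^sub>l\<close> has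
  expectation 0 under all other \<open>G\<^sub>m\<close>, so it identifies the outcome \<open>l\<close>. Conversely, a repeatable effect, with
  \<open>I\<^sup>*(1) = I\<^sup>*(G) = G\<close> satisfies \<open>(\<parallel>G\<parallel> - 1) G \<ge> 0\<close>, hence is 0 or has norm 1.

  The core is (2) to (3). Let \<open>b(X, Y) = \<Lambda>\<^sup>*(X \<otimes> Y)\<close>, symmetrised, let \<open>T X = b(X, 1)\<close>, and let \<open>F\<close> be the
  fixed space of \<open>T\<close>, which contains all effects of \<open>\<A>\<close>. The mean ergodic projection \<open>P\<close> onto \<open>F\<close> is
  positive, so \<open>X \<star> Y = P b(X, Y)\<close> is a positive bilinear product on \<open>F\<close> with unit 1. An extreme state
  of \<open>F\<close> is multiplicative for \<open>\<star>\<close>, because \<open>\<omega>(X \<star> -)\<close> and \<open>\<omega>((1 - X) \<star> -)\<close> decompose it. Distinct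
  multiplicative states are linearly independent, so there are finitely many, and the dual basis in
  \<open>F\<close> is a POVM of norm-1 effects whose coefficients in the expansion of \<open>X\<close> are the values \<open>\<omega>(X)\<close>.
\<close>

section \<open>Fixed points of a positive bilinear product\<close>

text \<open>The obstacle is that \<open>b(X, Y)\<close> need not be fixed by \<open>T\<close> when
  \<open>X\<close> and \<open>Y\<close> are, and that no associativity is available, so the
  classical structure cannot be read off from a commutative algebra. Projecting restores closure at
  no cost to the unit law, since \<open>b(X, 1) = X\<close> already holds on \<open>F\<close>.
  Positivity, bilinearity and the unit law carry the argument on extreme states, and separating two
  multiplicative states multiplies scalar values only. Positivity of the dual basis comes from a
  maximum principle: every element of \<open>F\<close> attains its maximum over the state space of
  \<open>F\<close> at a multiplicative state, so its sign is decided there. States of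
  \<open>F\<close> are constrained only through the order, which is why
  \<open>\<omega>(G) = 1\<close> yields norm 1 by way of
  \<open>G \<le> \<parallel>G\<parallel> 1\<close>. The ergodic projection is built without limits:
  the space splits into \<open>F\<close> and the range of \<open>1 - T\<close>, and boundedness of
  the orbits replaces convergence of the averages.\<close>

text \<open>Divide by \<open>n\<close> and let \<open>n\<close> grow. This Archimedean form stands
  in for every limit argument below.\<close>

lemma nonneg_if_multiples_bounded:
  fixes a c :: real
  assumes "\<And>n. - c \<le> real n * a"
  shows "0 \<le> a"
proof (rule ccontr)
  assume "\<not> 0 \<le> a"
  then obtain n where "c < real n * (- a)"
    using reals_Archimedean3[of "- a"] by auto
  with assms[of n] show False by simp
qed

text \<open>Dimension count on a subspace of a possibly infinite-dimensional type: the image of a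
  basis \<open>C\<close> of \<open>R\<close> is independent, and a vector of \<open>R\<close>
  outside its span would give more than \<open>card C\<close> independent vectors in
  \<open>span C\<close>.\<close>

lemma linear_injective_imp_image_eq:
  fixes f :: "'v::real_vector \<Rightarrow> 'v"
  assumes lin: "linear f" and R: "subspace R" and B: "finite B" "R \<subseteq> span B"
    and sub: "f ` R \<subseteq> R" and inj: "inj_on f R"
  shows "f ` R = R"
proof (rule antisym[OF sub], rule subsetI)
  fix y assume y: "y \<in> R"
  obtain C where C: "C \<subseteq> R" "independent C" "R \<subseteq> span C"
    by (rule maximal_independent_subset)
  have spanC: "span C = R"
    using C R by (metis antisym span_minimal)
  have finC: "finite C" "card C \<le> card B"
    using independent_span_bound[OF B(1) C(2)] C(1) B(2) by auto
  have ind: "independent (f ` C)"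
    using C(2) inj lin by (metis linear_independent_injective_image spanC)
  have injC: "inj_on f C" using inj C(1) by (rule inj_on_subset)
  have "y \<in> span (f ` C)"
  proof (rule ccontr)
    assume n: "y \<notin> span (f ` C)"
    then have i: "independent (insert y (f ` C))"
      using ind by (simp add: independent_insert)
    have "insert y (f ` C) \<subseteq> span C"
      using y sub C(1) spanC by auto
    then have "card (insert y (f ` C)) \<le> card C"
      using independent_span_bound[OF finC(1) i] by auto
    moreover have "card (insert y (f ` C)) = Suc (card C)"
      using n finC(1) injC by (metis card_image card_insert_disjoint finite_imageI span_base)
    ultimately show False by simp
  qed
  then show "y \<in> f ` R"
    using linear_span_image[OF lin, of C] spanC by simp
qed

text \<open>Quantifies strict convexity of squaring: for \<open>0 < t < 1\<close> the gap vanishes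
  only if \<open>x = y\<close>.\<close>

lemma convex_square_gap:
  fixes x y t :: real
  shows "t * x\<^sup>2 + (1 - t) * y\<^sup>2 - (t * x + (1 - t) * y)\<^sup>2 = t * (1 - t) * (x - y)\<^sup>2"
  by (simp add: power2_eq_square algebra_simps)

text \<open>Intended reading: \<open>W\<close> is the hermitian operators, \<open>S\<close> the pure
  states, \<open>u\<close> the identity. Order is tested by \<open>S\<close>, and
  \<open>S_bounded\<close> makes \<open>u\<close> an order unit. The set \<open>B\<close> expresses
  finite dimension, as \<open>'v\<close> will be a function type.\<close>

locale positive_bilinear =
  fixes W B :: "'v::real_vector set" and S :: "('v \<Rightarrow> real) set" and u :: 'v
    and b :: "'v \<Rightarrow> 'v \<Rightarrow> 'v"
  assumes W: "subspace W" and B: "finite B" "W \<subseteq> span B"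
    and u: "u \<in> W"
    and S_linear: "\<phi> \<in> S \<Longrightarrow> linear \<phi>"
    and S_unit: "\<phi> \<in> S \<Longrightarrow> \<phi> u = 1"
    and S_bounded: "x \<in> W \<Longrightarrow> \<exists>c. \<forall>\<phi>\<in>S. \<bar>\<phi> x\<bar> \<le> c"
    and S_separating: "x \<in> W \<Longrightarrow> (\<And>\<phi>. \<phi> \<in> S \<Longrightarrow> \<phi> x = 0) \<Longrightarrow> x = 0"
    and b_closed: "x \<in> W \<Longrightarrow> y \<in> W \<Longrightarrow> b x y \<in> W"
    and b_linear: "linear (b x)" "linear (\<lambda>x. b x y)"
    and b_pos: "x \<in> W \<Longrightarrow> y \<in> W \<Longrightarrow> (\<And>\<psi>. \<psi> \<in> S \<Longrightarrow> 0 \<le> \<psi> x) \<Longrightarrow>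
      (\<And>\<psi>. \<psi> \<in> S \<Longrightarrow> 0 \<le> \<psi> y) \<Longrightarrow> \<phi> \<in> S \<Longrightarrow> 0 \<le> \<phi> (b x y)"
    and b_marginals: "b u x = b x u"
    and b_unit: "b u u = u"
begin

section \<open>The marginal map and its order bounds\<close>

definition pos :: "'v \<Rightarrow> bool" where
  "pos x \<longleftrightarrow> (\<forall>\<phi>\<in>S. 0 \<le> \<phi> x)"

definition T :: "'v \<Rightarrow> 'v" where
  "T x = b x u"

definition F :: "'v set" where
  "F = {x \<in> W. T x = x}"

lemma linear_T: "linear T"
  using b_linear(2)[of u] by (simp add: T_def[abs_def])

lemma pos_u: "pos u"
  by (simp add: pos_def S_unit)

lemma pos_b: "x \<in> W \<Longrightarrow> y \<in> W \<Longrightarrow> pos x \<Longrightarrow> pos y \<Longrightarrow> pos (b x y)"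
  using b_pos unfolding pos_def by blast

lemma T_W: "x \<in> W \<Longrightarrow> T x \<in> W"
  using b_closed u by (simp add: T_def)

lemma pos_T: "x \<in> W \<Longrightarrow> pos x \<Longrightarrow> pos (T x)"
  using pos_b u pos_u by (simp add: T_def)

lemma T_u: "T u = u"
  by (simp add: T_def b_unit)

lemma T_pow_W: "x \<in> W \<Longrightarrow> (T ^^ n) x \<in> W"
  by (induction n) (auto simp: T_W)

lemma pos_T_pow: "x \<in> W \<Longrightarrow> pos x \<Longrightarrow> pos ((T ^^ n) x)"
  by (induction n) (auto simp: T_pow_W pos_T)

text \<open>Turns a bound on values into the order interval between \<open>-c u\<close> and
  \<open>c u\<close>, which positive unital maps preserve.\<close>

lemma abs_le_iff_pos:
  "(\<forall>\<phi>\<in>S. \<bar>\<phi> x\<bar> \<le> c) \<longleftrightarrow> pos (c *\<^sub>R u + x) \<and> pos (c *\<^sub>R u - x)"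
  unfolding pos_def
  by (auto simp: S_unit linear_add[OF S_linear] linear_diff[OF S_linear] linear_scale[OF S_linear]
      abs_le_iff)

lemma T_pow_bounded:
  assumes x: "x \<in> W" and c: "\<forall>\<phi>\<in>S. \<bar>\<phi> x\<bar> \<le> c"
  shows "\<forall>\<phi>\<in>S. \<bar>\<phi> ((T ^^ n) x)\<bar> \<le> c"
proof (induction n)
  case (Suc n)
  let ?y = "(T ^^ n) x"
  have y: "?y \<in> W" using x by (rule T_pow_W)
  have "pos (T (c *\<^sub>R u + ?y))" "pos (T (c *\<^sub>R u - ?y))"
    using Suc.IH W u y unfolding abs_le_iff_pos
    by (auto intro!: pos_T subspace_add subspace_diff subspace_scale)
  then show ?case
    unfolding abs_le_iff_pos
    by (simp add: linear_add[OF linear_T] linear_diff[OF linear_T] linear_scale[OF linear_T] T_u)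
qed (use c in simp)

lemma subspace_F: "subspace F"
  unfolding F_def using W linear_T
  by (auto simp: subspace_def linear_add linear_scale linear_0)

lemma F_W: "x \<in> F \<Longrightarrow> x \<in> W"
  by (simp add: F_def)

lemma u_F: "u \<in> F"
  by (simp add: F_def u T_u)

section \<open>Mean ergodic decomposition\<close>

text \<open>The kernel and the range of \<open>1 - T\<close> meet only in 0: if
  \<open>x = y - T y\<close> is fixed, then \<open>T^n y = y - n x\<close> drifts linearly, while
  positivity and unitality keep the orbit of \<open>y\<close> bounded.\<close>

lemma fixed_coboundary_zero:
  assumes y: "y \<in> W" and x: "T (y - T y) = y - T y"
  shows "y - T y = 0"
proof -
  let ?x = "y - T y"
  have pow: "(T ^^ n) y = y - real n *\<^sub>R ?x" for n
  proof (induction n)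
    case (Suc n)
    have "(T ^^ Suc n) y = T y - real n *\<^sub>R T ?x"
      by (simp add: Suc.IH linear_diff[OF linear_T] linear_scale[OF linear_T])
    then show ?case unfolding x by (simp add: algebra_simps)
  qed simp
  obtain c where c: "\<forall>\<phi>\<in>S. \<bar>\<phi> y\<bar> \<le> c" using S_bounded[OF y] by auto
  show ?thesis
  proof (rule S_separating)
    show "?x \<in> W" using W y T_W by (auto intro: subspace_diff)
    fix \<phi> assume \<phi>: "\<phi> \<in> S"
    have *: "\<bar>\<phi> y - real n * \<phi> ?x\<bar> \<le> c" for n
      using T_pow_bounded[OF y c, of n] \<phi>
      by (auto simp: pow linear_diff[OF S_linear] linear_scale[OF S_linear])
    have y: "\<bar>\<phi> y\<bar> \<le> c" using c \<phi> by blast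
    have "- (2 * c) \<le> real n * \<phi> ?x" "- (2 * c) \<le> real n * (- \<phi> ?x)" for n
      using *[of n] y by auto
    then have "0 \<le> \<phi> ?x" "0 \<le> - \<phi> ?x"
      using nonneg_if_multiples_bounded by blast+
    then show "\<phi> ?x = 0" by simp
  qed
qed

text \<open>By the trivial intersection, \<open>D = 1 - T\<close> is injective on its own range,
  hence maps that range onto itself. So \<open>D x = D (D y)\<close> is solvable and
  \<open>x - D y\<close> lies in the kernel \<open>F\<close>.\<close>

lemma ergodic_decomposition:
  assumes x: "x \<in> W"
  shows "\<exists>f\<in>F. \<exists>y\<in>W. x = f + (y - T y)"
proof -
  define D where "D y = y - T y" for y
  have lin: "linear D" unfolding D_def[abs_def]
    by (rule linear_compose_sub[OF linear_id[unfolded id_def] linear_T])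
  have DW: "D y \<in> W" if "y \<in> W" for y
    using that W T_W by (auto simp: D_def intro: subspace_diff)
  have "D ` (D ` W) = D ` W"
  proof (rule linear_injective_imp_image_eq[OF lin _ B(1)])
    show "subspace (D ` W)" using lin W by (rule linear_subspace_image)
    show "D ` W \<subseteq> span B" using DW B(2) by blast
    show "D ` D ` W \<subseteq> D ` W" using DW by blast
    show "inj_on D (D ` W)"
    proof (rule inj_onI)
      fix z z' assume "z \<in> D ` W" "z' \<in> D ` W" and eq: "D z = D z'"
      then obtain y y' where y: "y \<in> W" "y' \<in> W" "z = D y" "z' = D y'" by blast
      have "y - y' \<in> W" using W y by (auto intro: subspace_diff)
      moreover have "D (y - y') = z - z'" "D (z - z') = 0"
        using eq y by (simp_all add: linear_diff[OF lin])
      ultimately have "z - z' = 0"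
        using fixed_coboundary_zero[of "y - y'"] unfolding D_def by auto
      then show "z = z'" by simp
    qed
  qed
  then obtain y where y: "y \<in> W" "D x = D (D y)" using x by blast
  have "D (x - D y) = 0" using y(2) by (simp add: linear_diff[OF lin])
  then have "T (x - D y) = x - D y" by (simp add: D_def)
  moreover have "x - D y \<in> W" using W x DW[OF y(1)] by (rule subspace_diff)
  ultimately have "x - D y \<in> F" by (simp add: F_def)
  moreover have "x = (x - D y) + (y - T y)" by (simp add: D_def)
  ultimately show ?thesis using y(1) by blast
qed

text \<open>Projection onto \<open>F\<close> along the range of \<open>1 - T\<close>, the algebraic
  form of the Cesaro limit of the powers of \<open>T\<close>. Outside \<open>W\<close> its value is
  unspecified, so its laws carry membership in \<open>W\<close>.\<close>

definition P :: "'v \<Rightarrow> 'v" where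
  "P x = (THE f. f \<in> F \<and> (\<exists>y\<in>W. x = f + (y - T y)))"

lemma P_eqI:
  assumes "f \<in> F" "y \<in> W" "x = f + (y - T y)"
  shows "P x = f"
  unfolding P_def
proof (rule the_equality)
  show "f \<in> F \<and> (\<exists>y\<in>W. x = f + (y - T y))" using assms by blast
  fix g assume "g \<in> F \<and> (\<exists>y\<in>W. x = g + (y - T y))"
  then obtain z where z: "g \<in> F" "z \<in> W" "x = g + (z - T z)" by blast
  have eq: "(z - y) - T (z - y) = f - g"
    using z assms(3) by (simp add: linear_diff[OF linear_T] algebra_simps)
  have "f - g \<in> F" using subspace_F assms z by (auto intro: subspace_diff)
  then have "T (f - g) = f - g" by (simp add: F_def)
  moreover have "z - y \<in> W" using W z assms by (auto intro: subspace_diff)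
  ultimately have "f - g = 0" using fixed_coboundary_zero[of "z - y"] eq by simp
  then show "g = f" by simp
qed

lemma P_F: "x \<in> W \<Longrightarrow> P x \<in> F"
  using ergodic_decomposition P_eqI by metis

lemma P_id: "x \<in> F \<Longrightarrow> P x = x"
  using P_eqI[of x 0 x] W by (simp add: linear_0[OF linear_T] subspace_0)

lemma P_add: "x \<in> W \<Longrightarrow> y \<in> W \<Longrightarrow> P (x + y) = P x + P y"
proof -
  assume "x \<in> W" "y \<in> W"
  then obtain f g v w where *: "f \<in> F" "v \<in> W" "x = f + (v - T v)"
      "g \<in> F" "w \<in> W" "y = g + (w - T w)"
    by (meson ergodic_decomposition)
  then have "P (x + y) = f + g"
    using subspace_F W
    by (intro P_eqI[where y="v + w"])
      (simp_all add: linear_add[OF linear_T] subspace_add)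
  then show ?thesis using P_eqI * by metis
qed

lemma P_scale: "x \<in> W \<Longrightarrow> P (r *\<^sub>R x) = r *\<^sub>R P x"
proof -
  assume "x \<in> W"
  then obtain f v where *: "f \<in> F" "v \<in> W" "x = f + (v - T v)"
    by (meson ergodic_decomposition)
  then have "P (r *\<^sub>R x) = r *\<^sub>R f"
    using subspace_F W
    by (intro P_eqI[where y="r *\<^sub>R v"])
      (simp_all add: linear_scale[OF linear_T] subspace_scale scaleR_add_right scaleR_diff_right)
  then show ?thesis using P_eqI * by metis
qed

text \<open>Summing \<open>T^k x\<close> over \<open>k < n\<close> telescopes to
  \<open>n f + (y - T^n y)\<close>. The sum is nonnegative and the bracket is bounded by
  \<open>2 c\<close> in every state, so \<open>f\<close> is nonnegative.\<close>

lemma pos_P: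
  assumes x: "x \<in> W" "pos x"
  shows "pos (P x)"
proof -
  obtain f y where y: "f \<in> F" "y \<in> W" "x = f + (y - T y)"
    using ergodic_decomposition x(1) by blast
  have Tf: "(T ^^ n) f = f" for n
    using y(1) by (induction n) (auto simp: F_def)
  have lin: "linear (T ^^ n)" for n
    by (induction n) (simp_all add: linear_id[unfolded id_def] linear_compose[OF _ linear_T, unfolded o_def])
  have pow: "(T ^^ k) x = f + ((T ^^ k) y - (T ^^ Suc k) y)" for k
    by (simp add: y(3) linear_add[OF lin] linear_diff[OF lin] Tf funpow_swap1)
  obtain c where c: "\<forall>\<phi>\<in>S. \<bar>\<phi> y\<bar> \<le> c" using S_bounded y(2) by blast
  have "0 \<le> \<phi> f" if \<phi>: "\<phi> \<in> S" for \<phi>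
  proof (rule nonneg_if_multiples_bounded)
    fix n
    have "0 \<le> (\<Sum>k<n. \<phi> ((T ^^ k) x))"
      using pos_T_pow[OF x] \<phi> by (intro sum_nonneg) (auto simp: pos_def)
    also have "\<dots> = (\<Sum>k<n. \<phi> f + (\<phi> ((T ^^ k) y) - \<phi> ((T ^^ Suc k) y)))"
      unfolding pow linear_add[OF S_linear[OF \<phi>]] linear_diff[OF S_linear[OF \<phi>]] ..
    also have "\<dots> = real n * \<phi> f + (\<phi> y - \<phi> ((T ^^ n) y))"
      unfolding sum.distrib sum_lessThan_telescope'[where f="\<lambda>k. \<phi> ((T ^^ k) y)"] by simp
    finally show "- (2 * c) \<le> real n * \<phi> f"
      using T_pow_bounded[OF y(2) c, of n] c \<phi> by fastforce
  qed
  then show ?thesis using P_eqI y by (metis pos_def)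
qed

section \<open>The projected product and the states of the fixed space\<close>

definition star :: "'v \<Rightarrow> 'v \<Rightarrow> 'v" (infixl "\<star>" 70) where
  "x \<star> y = P (b x y)"

lemma star_F: "x \<in> F \<Longrightarrow> y \<in> F \<Longrightarrow> x \<star> y \<in> F"
  by (simp add: star_def P_F b_closed F_W)

lemma star_add:
  assumes "x \<in> F" "y \<in> F" "z \<in> F"
  shows "(x + y) \<star> z = x \<star> z + y \<star> z" "z \<star> (x + y) = z \<star> x + z \<star> y"
  using assms
  by (simp_all add: star_def linear_add[OF b_linear(1)] linear_add[OF b_linear(2)] P_add b_closed F_W)

lemma star_scale:
  assumes "x \<in> F" "y \<in> F"
  shows "(r *\<^sub>R x) \<star> y = r *\<^sub>R (x \<star> y)" "x \<star> (r *\<^sub>R y) = r *\<^sub>R (x \<star> y)"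
  using assms
  by (simp_all add: star_def linear_scale[OF b_linear(1)] linear_scale[OF b_linear(2)] P_scale b_closed F_W)

lemma star_u: "x \<in> F \<Longrightarrow> x \<star> u = x" "x \<in> F \<Longrightarrow> u \<star> x = x"
  using P_id by (simp_all add: star_def b_marginals F_def T_def)

lemma pos_star: "x \<in> F \<Longrightarrow> y \<in> F \<Longrightarrow> pos x \<Longrightarrow> pos y \<Longrightarrow> pos (x \<star> y)"
  by (simp add: star_def pos_P pos_b b_closed F_W)

text \<open>The value 0 off \<open>F\<close> makes functionals that agree on \<open>F\<close> equal,
  so extremality can be stated as an equation of functions and the off-\<open>F\<close> coordinates
  do not spoil compactness.\<close>

definition K :: "('v \<Rightarrow> real) set" where
  "K = {\<omega>. (\<forall>x. x \<notin> F \<longrightarrow> \<omega> x = 0) \<and> (\<forall>x\<in>F. \<forall>y\<in>F. \<omega> (x + y) = \<omega> x + \<omega> y) \<and>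
     (\<forall>x\<in>F. \<forall>r. \<omega> (r *\<^sub>R x) = r * \<omega> x) \<and> \<omega> u = 1 \<and> (\<forall>x\<in>F. pos x \<longrightarrow> 0 \<le> \<omega> x)}"

lemma K_D:
  assumes "\<omega> \<in> K"
  shows "x \<notin> F \<Longrightarrow> \<omega> x = 0" "x \<in> F \<Longrightarrow> y \<in> F \<Longrightarrow> \<omega> (x + y) = \<omega> x + \<omega> y"
    "x \<in> F \<Longrightarrow> \<omega> (r *\<^sub>R x) = r * \<omega> x" "\<omega> u = 1" "x \<in> F \<Longrightarrow> pos x \<Longrightarrow> 0 \<le> \<omega> x"
  using assms unfolding K_def by blast+

lemma K_diff: "\<omega> \<in> K \<Longrightarrow> x \<in> F \<Longrightarrow> y \<in> F \<Longrightarrow> \<omega> (x - y) = \<omega> x - \<omega> y"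
  using K_D(2)[of \<omega> x "(-1) *\<^sub>R y"] K_D(3)[of \<omega> y "-1"] subspace_scale[OF subspace_F, of y "-1"]
  by simp

lemma K_sum:
  assumes "\<omega> \<in> K" "\<And>i. i \<in> I \<Longrightarrow> f i \<in> F"
  shows "\<omega> (\<Sum>i\<in>I. f i) = (\<Sum>i\<in>I. \<omega> (f i))"
  using assms(2)
proof (induction I rule: infinite_finite_induct)
  case (insert i I)
  then have "sum f I \<in> F" using subspace_F by (auto intro: subspace_sum)
  with insert K_D(2)[OF assms(1)] show ?case by simp
qed (use K_D(3)[OF assms(1), of 0 0] subspace_0[OF subspace_F] in auto)

lemma restrict_S_K:
  assumes "\<phi> \<in> S"
  shows "(\<lambda>x. if x \<in> F then \<phi> x else 0) \<in> K"
  using assms subspace_F u_F unfolding K_def pos_def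
  by (auto simp: linear_add[OF S_linear] linear_scale[OF S_linear] S_unit
      dest: subspace_add subspace_scale)

text \<open>A bound valid on \<open>S\<close> is an order interval around 0, and every positive
  unital functional respects it.\<close>

lemma K_bounded:
  assumes x: "x \<in> F"
  shows "\<exists>c. \<forall>\<omega>\<in>K. \<bar>\<omega> x\<bar> \<le> c"
proof -
  obtain c where c: "\<forall>\<phi>\<in>S. \<bar>\<phi> x\<bar> \<le> c" using S_bounded F_W[OF x] by blast
  have cu: "c *\<^sub>R u \<in> F" using subspace_F u_F by (rule subspace_scale)
  have F: "c *\<^sub>R u + x \<in> F" "c *\<^sub>R u - x \<in> F"
    using subspace_F cu x by (auto intro: subspace_add subspace_diff)
  have "\<bar>\<omega> x\<bar> \<le> c" if \<omega>: "\<omega> \<in> K" for \<omega>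
  proof -
    have "0 \<le> \<omega> (c *\<^sub>R u + x)" "0 \<le> \<omega> (c *\<^sub>R u - x)"
      using c F K_D(5)[OF \<omega>] unfolding abs_le_iff_pos by auto
    then show ?thesis
      using K_D(2)[OF \<omega> cu x] K_diff[OF \<omega> cu x] K_D(3)[OF \<omega> u_F, of c] K_D(4)[OF \<omega>] by simp
  qed
  then show ?thesis by blast
qed

text \<open>Tychonoff in the space of functions \<open>'v \<Rightarrow> real\<close>: every defining
  condition of \<open>K\<close> is closed for pointwise convergence, and the pointwise bounds
  confine \<open>K\<close> to a product of intervals.\<close>

lemma compact_K: "compact K"
proof -
  obtain c where c: "\<And>x \<omega>. x \<in> F \<Longrightarrow> \<omega> \<in> K \<Longrightarrow> \<bar>\<omega> x\<bar> \<le> c x"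
    using K_bounded by metis
  define c' where "c' x = (if x \<in> F then c x else 0)" for x
  have "compactin (product_topology (\<lambda>_::'v. euclidean) UNIV) (PiE UNIV (\<lambda>x. {- c' x..c' x}))"
    unfolding compactin_PiE by simp
  then have comp: "compact (PiE UNIV (\<lambda>x::'v. {- c' x..c' x}))"
    by (simp add: euclidean_product_topology)
  have ev: "continuous_on UNIV (\<lambda>\<omega>. \<omega> x :: real)" for x :: 'v
    by simp
  have eq: "closed {\<omega>::'v \<Rightarrow> real. f \<omega> = (g \<omega> :: real)}"
    if "continuous_on UNIV f" "continuous_on UNIV g" for f g
    using closed_Collect_eq that .
  have "closed {\<omega> :: 'v \<Rightarrow> real. \<forall>x. x \<notin> F \<longrightarrow> \<omega> x = 0}"
    by (intro closed_Collect_all closed_Collect_imp open_Collect_const eq ev continuous_on_const)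
  moreover have "closed {\<omega> :: 'v \<Rightarrow> real. \<forall>x. x \<in> F \<longrightarrow> (\<forall>y. y \<in> F \<longrightarrow> \<omega> (x + y) = \<omega> x + \<omega> y)}"
    by (intro closed_Collect_all closed_Collect_imp open_Collect_const eq ev continuous_on_add)
  moreover have "closed {\<omega> :: 'v \<Rightarrow> real. \<forall>x. x \<in> F \<longrightarrow> (\<forall>r. \<omega> (r *\<^sub>R x) = r * \<omega> x)}"
    by (intro closed_Collect_all closed_Collect_imp open_Collect_const eq ev continuous_on_mult
        continuous_on_const)
  moreover have "closed {\<omega> :: 'v \<Rightarrow> real. \<omega> u = 1}"
    by (intro eq ev continuous_on_const)
  moreover have "closed {\<omega> :: 'v \<Rightarrow> real. \<forall>x. x \<in> F \<longrightarrow> pos x \<longrightarrow> 0 \<le> \<omega> x}"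
    by (intro closed_Collect_all closed_Collect_imp open_Collect_const closed_Collect_le ev
        continuous_on_const)
  ultimately have "closed K"
    unfolding K_def Ball_def by (intro closed_Collect_conj)
  moreover have "K \<subseteq> PiE UNIV (\<lambda>x. {- c' x..c' x})"
  proof (rule subsetI, rule PiE_I)
    fix \<omega> x assume "\<omega> \<in> K"
    then show "\<omega> x \<in> {- c' x..c' x}"
      using c[of x \<omega>] K_D(1)[of \<omega> x] by (auto simp: c'_def abs_le_iff)
  qed auto
  ultimately show ?thesis
    using comp compact_Int_closed inf.absorb_iff2 by metis
qed

section \<open>Extreme states are multiplicative\<close>

definition mult_states :: "('v \<Rightarrow> real) set" where
  "mult_states = {\<omega> \<in> K. \<forall>x\<in>F. \<forall>y\<in>F. \<omega> (x \<star> y) = \<omega> x * \<omega> y}"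

text \<open>Only \<open>\<alpha> = \<omega>\<close> is demanded; as \<open>t < 1\<close>, the convex
  equation then forces \<open>\<beta> = \<omega>\<close>.\<close>

definition extreme_state :: "('v \<Rightarrow> real) \<Rightarrow> bool" where
  "extreme_state \<omega> \<longleftrightarrow> \<omega> \<in> K \<and> (\<forall>\<alpha>\<in>K. \<forall>\<beta>\<in>K. \<forall>t. 0 < t \<longrightarrow> t < 1 \<longrightarrow>
     (\<forall>x. \<omega> x = t * \<alpha> x + (1 - t) * \<beta> x) \<longrightarrow> \<alpha> = \<omega>)"

text \<open>The conditional state given the effect \<open>x\<close>: the right unit law normalises
  it and positivity of \<open>\<star>\<close> makes it positive.\<close>

lemma slice_state:
  assumes \<omega>: "\<omega> \<in> K" and x: "x \<in> F" "pos x" "0 < \<omega> x"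
  shows "(\<lambda>y. if y \<in> F then \<omega> (x \<star> y) / \<omega> x else 0) \<in> K"
  using x subspace_F u_F unfolding K_def
  by (auto simp: star_add star_scale star_u star_F K_D[OF \<omega>] pos_star add_divide_distrib
      dest: subspace_add subspace_scale)

text \<open>For an effect \<open>x\<close> the slices by \<open>x\<close> and \<open>u - x\<close>
  have weights \<open>\<omega> x\<close> and \<open>1 - \<omega> x\<close>. An arbitrary
  \<open>x\<close> is reached by an affine change into the effects, harmless because the
  multiplicative law is linear in \<open>x\<close> and holds for \<open>u\<close>.\<close>

lemma extreme_state_mult:
  assumes ext: "extreme_state \<omega>"
  shows "\<omega> \<in> mult_states"
proof -
  have \<omega>: "\<omega> \<in> K" using ext by (simp add: extreme_state_def)
  have sharp: "\<omega> (x \<star> y) = \<omega> x * \<omega> y"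
    if x: "x \<in> F" "pos x" "pos (u - x)" "0 < \<omega> x" "\<omega> x < 1" and y: "y \<in> F" for x y
  proof -
    have x': "u - x \<in> F" using subspace_F u_F x(1) by (rule subspace_diff)
    have wx': "\<omega> (u - x) = 1 - \<omega> x" by (simp add: K_diff[OF \<omega>] x u_F K_D[OF \<omega>])
    let ?\<alpha> = "\<lambda>y. if y \<in> F then \<omega> (x \<star> y) / \<omega> x else 0"
    let ?\<beta> = "\<lambda>y. if y \<in> F then \<omega> ((u - x) \<star> y) / \<omega> (u - x) else 0"
    have "?\<alpha> \<in> K" using \<omega> x by (intro slice_state)
    moreover have "?\<beta> \<in> K" using \<omega> x x' wx' by (intro slice_state) auto
    moreover have "\<omega> z = \<omega> x * ?\<alpha> z + (1 - \<omega> x) * ?\<beta> z" for z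
    proof (cases "z \<in> F")
      case True
      have "\<omega> z = \<omega> ((x + (u - x)) \<star> z)" using True by (simp add: star_u)
      also have "\<dots> = \<omega> (x \<star> z) + \<omega> ((u - x) \<star> z)"
        using True x x' by (simp only: star_add star_F K_D[OF \<omega>])
      finally show ?thesis using True x wx' by simp
    qed (simp add: K_D[OF \<omega>])
    ultimately have "?\<alpha> = \<omega>"
      using ext[unfolded extreme_state_def, THEN conjunct2, rule_format, OF _ _ x(4,5)] by blast
    from fun_cong[OF this, of y] show ?thesis using x y by (simp add: field_simps)
  qed
  have "\<omega> (x \<star> y) = \<omega> x * \<omega> y" if x: "x \<in> F" and y: "y \<in> F" for x y
  proof -
    obtain c where c: "\<forall>\<phi>\<in>S. \<bar>\<phi> x\<bar> \<le> c" using S_bounded F_W[OF x] by blast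
    \<comment> \<open>Since \<open>\<bar>\<phi> x\<bar> \<le> c\<close> on \<open>S\<close>, this
      scale keeps \<open>e \<phi>(x)\<close> within 1/4 of zero; the form
      \<open>\<bar>c\<bar> + 1\<close> makes it positive for every \<open>c\<close>.\<close>
    define e where "e = inverse (4 * (\<bar>c\<bar> + 1))"
    have e: "0 < e" by (simp add: e_def)
    have ec: "e * c \<le> 1 / 4" by (simp add: e_def field_simps)
    \<comment> \<open>Rescaling keeps \<open>x'\<close> away from the boundary values 0 and 1, where \<open>sharp\<close> does not apply.\<close>
    define x' where "x' = (1/2) *\<^sub>R u + e *\<^sub>R x"
    have uF: "r *\<^sub>R u \<in> F" and exF: "e *\<^sub>R x \<in> F" for r
      using subspace_F u_F x by (auto intro: subspace_scale)
    have x'F: "x' \<in> F" unfolding x'_def using subspace_F uF exF by (rule subspace_add)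
    have bd: "1 / 4 \<le> \<phi> x' \<and> \<phi> x' \<le> 3 / 4" if "\<phi> \<in> S" for \<phi>
    proof -
      have "\<bar>\<phi> x\<bar> \<le> c" using c that by blast
      then have "e * \<bar>\<phi> x\<bar> \<le> e * c" using e by (intro mult_left_mono) auto
      then have "e * \<bar>\<phi> x\<bar> \<le> 1 / 4" using ec by linarith
      then have "\<bar>e * \<phi> x\<bar> \<le> 1 / 4" using e by (simp add: abs_mult)
      moreover have "\<phi> x' = 1 / 2 + e * \<phi> x"
        using that by (simp add: x'_def linear_add[OF S_linear] linear_scale[OF S_linear] S_unit)
      ultimately show ?thesis by (simp only:) arith
    qed
    \<comment> \<open>The numerical bounds hold on \<open>S\<close>; they are recast as positivity
      because that is all an element of \<open>K\<close> respects.\<close>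
    have p: "pos x'" "pos (u - x')" "pos (x' - (1/4) *\<^sub>R u)" "pos ((3/4) *\<^sub>R u - x')"
      using bd unfolding pos_def
      by (fastforce simp: linear_diff[OF S_linear] linear_scale[OF S_linear] S_unit)+
    have "0 \<le> \<omega> (x' - (1/4) *\<^sub>R u)" "0 \<le> \<omega> ((3/4) *\<^sub>R u - x')"
      using p uF x'F subspace_F by (auto intro!: K_D(5)[OF \<omega>] subspace_diff)
    then have "1 / 4 \<le> \<omega> x'" "\<omega> x' \<le> 3 / 4"
      by (simp_all add: K_diff[OF \<omega>] uF x'F K_D(3)[OF \<omega>] K_D(4)[OF \<omega>] u_F)
    then have "\<omega> (x' \<star> y) = \<omega> x' * \<omega> y"
      using sharp[OF x'F p(1,2) _ _ y] by simp
    moreover have "\<omega> (x' \<star> y) = \<omega> y / 2 + e * \<omega> (x \<star> y)"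
      unfolding x'_def
      using x y uF exF u_F
      by (simp add: star_add star_scale star_F star_u K_D[OF \<omega>] subspace_scale[OF subspace_F])
    moreover have "\<omega> x' = 1 / 2 + e * \<omega> x"
      unfolding x'_def using x uF exF u_F by (simp add: K_D[OF \<omega>])
    \<comment> \<open>The contribution \<open>\<omega> y / 2\<close> of \<open>u\<close> cancels,
      and division by \<open>e\<close> leaves the law for \<open>x\<close>.\<close>
    ultimately show ?thesis using e by (simp add: algebra_simps)
  qed
  then show ?thesis using \<omega> by (simp add: mult_states_def)
qed

text \<open>A strictly convex function attains its maximum over a compact convex set only at extreme
  points; here the set is the face of maximisers of \<open>x\<close>, and the function is a sum of squares over
  a generating set.\<close>

lemma mult_state_maximises:
  assumes x: "x \<in> F" and K: "K \<noteq> {}"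
  shows "\<exists>\<omega>\<in>mult_states. \<forall>\<eta>\<in>K. \<eta> x \<le> \<omega> x"
proof -
  obtain C where C: "C \<subseteq> F" "independent C" "F \<subseteq> span C"
    by (rule maximal_independent_subset)
  have "C \<subseteq> span B" using C(1) F_W B(2) by blast
  then have finC: "finite C"
    using independent_span_bound[OF B(1) C(2)] by simp
  have ev: "continuous_on A (\<lambda>\<omega>. \<omega> y :: real)" for A and y :: 'v
    by (rule continuous_on_subset[of UNIV]) auto
  obtain \<omega>0 where \<omega>0: "\<omega>0 \<in> K" "\<forall>\<eta>\<in>K. \<eta> x \<le> \<omega>0 x"
    using continuous_attains_sup[OF compact_K K ev[of K x]] by blast
  define \<Phi> where "\<Phi> = K \<inter> {\<omega>. \<omega> x = \<omega>0 x}"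
  have "closed {\<omega> :: 'v \<Rightarrow> real. \<omega> x = \<omega>0 x}"
    by (intro closed_Collect_eq ev continuous_on_const)
  then have "compact \<Phi>" unfolding \<Phi>_def using compact_K by (rule compact_Int_closed[rotated])
  moreover have "\<Phi> \<noteq> {}" using \<omega>0 by (auto simp: \<Phi>_def)
  moreover have "continuous_on \<Phi> (\<lambda>\<omega>. \<Sum>y\<in>C. (\<omega> y)\<^sup>2)"
    by (intro continuous_on_sum continuous_on_power ev)
  ultimately obtain \<omega> where \<omega>: "\<omega> \<in> \<Phi>" "\<forall>\<eta>\<in>\<Phi>. (\<Sum>y\<in>C. (\<eta> y)\<^sup>2) \<le> (\<Sum>y\<in>C. (\<omega> y)\<^sup>2)"
    using continuous_attains_sup by blast
  have wK: "\<omega> \<in> K" "\<omega> x = \<omega>0 x" using \<omega>(1) by (auto simp: \<Phi>_def)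
  have "extreme_state \<omega>"
    unfolding extreme_state_def
  proof (intro conjI ballI allI impI wK(1))
    fix \<alpha> \<beta> t assume \<alpha>: "\<alpha> \<in> K" and \<beta>: "\<beta> \<in> K" and t: "0 < t" "t < 1"
      and eq: "\<forall>z. \<omega> z = t * \<alpha> z + (1 - t) * \<beta> z"
    have "\<alpha> x \<le> \<omega> x" "\<beta> x \<le> \<omega> x" using \<omega>0(2) \<alpha> \<beta> wK by auto
    moreover have "t * (\<omega> x - \<alpha> x) + (1 - t) * (\<omega> x - \<beta> x) = 0"
      using eq[rule_format, of x] by (simp add: algebra_simps)
    \<comment> \<open>Two values that do not exceed the maximum and average to it both equal it, so
      \<open>\<alpha>\<close> and \<open>\<beta>\<close> remain in the face of maximisers.\<close>
    ultimately have "t * (\<omega> x - \<alpha> x) = 0 \<and> (1 - t) * (\<omega> x - \<beta> x) = 0"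
      using t by (subst (asm) add_nonneg_eq_0_iff) auto
    then have "\<alpha> \<in> \<Phi>" "\<beta> \<in> \<Phi>" using t \<alpha> \<beta> wK by (auto simp: \<Phi>_def)
    then have le: "(\<Sum>y\<in>C. (\<alpha> y)\<^sup>2) \<le> (\<Sum>y\<in>C. (\<omega> y)\<^sup>2)" "(\<Sum>y\<in>C. (\<beta> y)\<^sup>2) \<le> (\<Sum>y\<in>C. (\<omega> y)\<^sup>2)"
      using \<omega>(2) by auto
    \<comment> \<open>The left side is the total convexity gap. Neither endpoint has a larger sum of
      squares than \<open>\<omega>\<close>, so the gap is squeezed to 0.\<close>
    have "(\<Sum>y\<in>C. t * (1 - t) * (\<alpha> y - \<beta> y)\<^sup>2)
        = t * (\<Sum>y\<in>C. (\<alpha> y)\<^sup>2) + (1 - t) * (\<Sum>y\<in>C. (\<beta> y)\<^sup>2) - (\<Sum>y\<in>C. (\<omega> y)\<^sup>2)"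
      unfolding convex_square_gap[symmetric] eq[rule_format]
      by (simp add: sum.distrib sum_subtractf sum_distrib_left)
    also have "\<dots> \<le> t * (\<Sum>y\<in>C. (\<omega> y)\<^sup>2) + (1 - t) * (\<Sum>y\<in>C. (\<omega> y)\<^sup>2) - (\<Sum>y\<in>C. (\<omega> y)\<^sup>2)"
      using le t by (intro diff_right_mono add_mono mult_left_mono) auto
    also have "\<dots> = 0" by (simp add: algebra_simps)
    finally have "(\<Sum>y\<in>C. t * (1 - t) * (\<alpha> y - \<beta> y)\<^sup>2) \<le> 0" .
    then have "(\<Sum>y\<in>C. t * (1 - t) * (\<alpha> y - \<beta> y)\<^sup>2) = 0"
      using t by (intro antisym sum_nonneg) auto
    then have "\<forall>y\<in>C. t * (1 - t) * (\<alpha> y - \<beta> y)\<^sup>2 = 0"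
      using t finC by (subst (asm) sum_nonneg_eq_0_iff) auto
    then have "\<forall>y\<in>C. \<alpha> y = \<beta> y" using t by auto
    then have "\<forall>y\<in>C. \<alpha> y = \<omega> y" unfolding eq[rule_format] by (simp add: algebra_simps)
    \<comment> \<open>Elements of \<open>K\<close> are linear only on \<open>F\<close>, hence
      membership in \<open>F\<close> is carried through the span induction.\<close>
    moreover have "\<alpha> y = \<omega> y \<and> y \<in> F" if "y \<in> span C" for y
      using that
    proof (induction rule: span_induct_alt)
      case base
      then show ?case
        using K_D(3)[OF \<alpha>, of 0 0] K_D(3)[OF wK(1), of 0 0] subspace_0[OF subspace_F] by simp
    next
      case (step r z y)
      then have "r *\<^sub>R z \<in> F" "z \<in> F" using C(1) subspace_F by (auto intro: subspace_scale)
      with step calculation show ?case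
        using K_D(2,3)[OF \<alpha>] K_D(2,3)[OF wK(1)] subspace_F by (auto intro: subspace_add)
    qed
    ultimately show "\<alpha> = \<omega>"
      using C(3) K_D(1)[OF \<alpha>] K_D(1)[OF wK(1)] by (metis ext subset_iff)
  qed
  then have "\<omega> \<in> mult_states" by (rule extreme_state_mult)
  then show ?thesis using \<omega>0(2) wK(2) by (intro bexI[of _ \<omega>]) simp
qed

section \<open>Finitely many multiplicative states and their dual basis\<close>

text \<open>Lagrange interpolation: one factor per state to be annihilated, multiplied up with
  \<open>\<star>\<close>. Multiplicative states evaluate each product factor by factor, so the
  bracketing chosen by the induction is immaterial.\<close>

lemma mult_states_separated:
  assumes fin: "finite D" and D: "D \<subseteq> mult_states" and \<omega>: "\<omega> \<in> mult_states" "\<omega> \<notin> D"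
  shows "\<exists>g\<in>F. \<omega> g = 1 \<and> (\<forall>\<eta>\<in>D. \<eta> g = 0)"
  using fin D \<omega>(2)
proof (induction D)
  case empty
  show ?case using \<omega>(1) u_F by (auto intro!: bexI[of _ u] simp: mult_states_def K_D)
next
  case (insert \<eta> D)
  then obtain g where g: "g \<in> F" "\<omega> g = 1" "\<forall>\<eta>\<in>D. \<eta> g = 0" by auto
  have K: "\<omega> \<in> K" "\<eta> \<in> K" using \<omega>(1) insert.prems by (auto simp: mult_states_def)
  have "\<omega> \<noteq> \<eta>" using insert.prems by auto
  then obtain y where y: "\<omega> y \<noteq> \<eta> y" by blast
  then have yF: "y \<in> F" using K_D(1)[OF K(1)] K_D(1)[OF K(2)] by metis
  \<comment> \<open>The interpolation factor, which is 1 at \<open>\<omega>\<close> and 0 at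
    \<open>\<eta>\<close>; it exists because the two states differ at some \<open>y\<close> in
    \<open>F\<close>.\<close>
  define h where "h = (1 / (\<omega> y - \<eta> y)) *\<^sub>R (y - \<eta> y *\<^sub>R u)"
  have *: "\<eta> y *\<^sub>R u \<in> F" "y - \<eta> y *\<^sub>R u \<in> F"
    using subspace_F u_F yF by (auto intro: subspace_scale subspace_diff)
  then have hF: "h \<in> F" unfolding h_def using subspace_F by (auto intro: subspace_scale)
  have "\<omega> h = 1" "\<eta> h = 0"
    unfolding h_def using y * yF u_F
    by (simp_all add: K_D(3,4)[OF K(1)] K_D(3,4)[OF K(2)] K_diff[OF K(1)] K_diff[OF K(2)])
  then have "\<omega> (g \<star> h) = 1" "\<forall>\<zeta>\<in>insert \<eta> D. \<zeta> (g \<star> h) = 0"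
    using g hF insert.prems \<omega>(1) by (auto simp: mult_states_def)
  then show ?case using star_F[OF g(1) hF] by blast
qed

lemma dual_family:
  assumes "finite D" "D \<subseteq> mult_states"
  shows "\<exists>G. \<forall>\<omega>\<in>D. G \<omega> \<in> F \<and> (\<forall>\<eta>\<in>D. \<eta> (G \<omega>) = (if \<eta> = \<omega> then 1 else 0))"
proof -
  have "\<exists>g. g \<in> F \<and> (\<forall>\<eta>\<in>D. \<eta> g = (if \<eta> = \<omega> then 1 else 0))" if "\<omega> \<in> D" for \<omega>
    using mult_states_separated[of "D - {\<omega>}" \<omega>] assms that by auto
  then show ?thesis by metis
qed

text \<open>A dual family for \<open>n\<close> multiplicative states consists of \<open>n\<close>
  independent vectors in \<open>span B\<close>, so \<open>n \<le> card B\<close>.\<close>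

lemma finite_mult_states: "finite mult_states"
proof (rule ccontr)
  assume "infinite mult_states"
  then obtain D where D: "finite D" "card D = Suc (card B)" "D \<subseteq> mult_states"
    by (rule infinite_arbitrarily_large[THEN exE]) auto
  obtain G where G: "\<And>\<omega>. \<omega> \<in> D \<Longrightarrow> G \<omega> \<in> F"
    and dual: "\<And>\<omega> \<eta>. \<omega> \<in> D \<Longrightarrow> \<eta> \<in> D \<Longrightarrow> \<eta> (G \<omega>) = (if \<eta> = \<omega> then 1 else 0)"
    using dual_family[OF D(1,3)] by metis
  have inj: "inj_on G D"
    using dual by (intro inj_onI) (metis zero_neq_one)
  have "independent (G ` D)"
    unfolding dependent_finite[OF finite_imageI[OF D(1)]]
  proof clarify
    fix c \<eta> assume sum: "(\<Sum>v\<in>G ` D. c v *\<^sub>R v) = 0" and \<eta>: "\<eta> \<in> D" "c (G \<eta>) \<noteq> 0"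
    have \<eta>K: "\<eta> \<in> K" using D \<eta> by (auto simp: mult_states_def)
    have "0 = \<eta> (\<Sum>\<omega>\<in>D. c (G \<omega>) *\<^sub>R G \<omega>)"
      using sum sum.reindex[OF inj, of "\<lambda>v. c v *\<^sub>R v"] K_D(3)[OF \<eta>K, of 0 0]
        subspace_0[OF subspace_F] by (simp add: o_def)
    also have "\<dots> = (\<Sum>\<omega>\<in>D. \<eta> (c (G \<omega>) *\<^sub>R G \<omega>))"
      using G subspace_F by (intro K_sum[OF \<eta>K]) (auto intro: subspace_scale)
    also have "\<dots> = (\<Sum>\<omega>\<in>D. if \<eta> = \<omega> then c (G \<omega>) else 0)"
      using \<eta> by (intro sum.cong) (auto simp: K_D(3)[OF \<eta>K] G dual)
    also have "\<dots> = c (G \<eta>)" using D(1) \<eta>(1) by simp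
    finally show False using \<eta>(2) by simp
  qed
  then have "card (G ` D) \<le> card B"
    using G F_W B independent_span_bound by (metis (no_types, lifting) image_subset_iff subset_iff)
  then show False using card_image[OF inj] D(2) by simp
qed

text \<open>As an ordered space \<open>F\<close> is the functions on the finite set of
  multiplicative states, with the dual basis as indicator functions.\<close>

theorem fixed_points_classical:
  assumes S: "S \<noteq> {}"
  shows "\<exists>D G. finite D \<and> D \<subseteq> K \<and> (\<forall>\<omega>\<in>D. G \<omega> \<in> F \<and> pos (G \<omega>) \<and> \<omega> (G \<omega>) = 1) \<and>
    (\<forall>x\<in>F. x = (\<Sum>\<omega>\<in>D. \<omega> x *\<^sub>R G \<omega>))"
proof -
  let ?D = mult_states
  obtain G where G: "\<And>\<omega>. \<omega> \<in> ?D \<Longrightarrow> G \<omega> \<in> F"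
    and dual: "\<And>\<omega> \<eta>. \<omega> \<in> ?D \<Longrightarrow> \<eta> \<in> ?D \<Longrightarrow> \<eta> (G \<omega>) = (if \<eta> = \<omega> then 1 else 0)"
    using dual_family[OF finite_mult_states] by blast
  have K: "K \<noteq> {}" using S restrict_S_K by blast
  have DK: "?D \<subseteq> K" by (auto simp: mult_states_def)
  \<comment> \<open>The maximum of \<open>x\<close> over \<open>K\<close> is attained at a
    multiplicative state, so nonpositivity on those states spreads to all of \<open>S\<close>.
    Applied to \<open>-G \<omega>\<close> it gives positivity; applied to \<open>x - ?y\<close> and
    its negative it gives the expansion.\<close>
  have nonpos: "\<phi> x \<le> 0" if "x \<in> F" "\<forall>\<omega>\<in>?D. \<omega> x \<le> 0" "\<phi> \<in> S" for x \<phi>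
    using mult_state_maximises[OF that(1) K] restrict_S_K[OF that(3)] that(1,2) by force
  have "pos (G \<omega>)" if "\<omega> \<in> ?D" for \<omega>
  proof -
    have "(-1) *\<^sub>R G \<omega> \<in> F" using subspace_F G[OF that] by (rule subspace_scale)
    moreover have "\<forall>\<eta>\<in>?D. \<eta> ((-1) *\<^sub>R G \<omega>) \<le> 0"
      using DK G that by (auto simp del: scaleR_minus_left scaleR_minus1_left simp: K_D(3) dual)
    ultimately have "\<phi> ((-1) *\<^sub>R G \<omega>) \<le> 0" if "\<phi> \<in> S" for \<phi>
      using nonpos that by blast
    then show ?thesis
      unfolding pos_def by (metis S_linear linear_scale mult_minus1 neg_le_0_iff_le real_scaleR_def)
  qed
  moreover have "x = (\<Sum>\<omega>\<in>?D. \<omega> x *\<^sub>R G \<omega>)" if x: "x \<in> F" for x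
  proof -
    let ?y = "\<Sum>\<omega>\<in>?D. \<omega> x *\<^sub>R G \<omega>"
    have t: "\<omega> x *\<^sub>R G \<omega> \<in> F" if "\<omega> \<in> ?D" for \<omega>
      using subspace_F G[OF that] by (rule subspace_scale)
    then have y: "?y \<in> F" using subspace_F by (auto intro: subspace_sum)
    have eq: "\<eta> ?y = \<eta> x" if \<eta>: "\<eta> \<in> ?D" for \<eta>
    proof -
      have \<eta>K: "\<eta> \<in> K" using DK \<eta> by auto
      have "\<eta> ?y = (\<Sum>\<omega>\<in>?D. \<eta> (\<omega> x *\<^sub>R G \<omega>))" using t by (intro K_sum[OF \<eta>K])
      also have "\<dots> = (\<Sum>\<omega>\<in>?D. if \<eta> = \<omega> then \<omega> x else 0)"
        using \<eta> by (intro sum.cong) (auto simp: K_D(3)[OF \<eta>K] G dual)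
      finally show ?thesis using \<eta> finite_mult_states by simp
    qed
    have d: "x - ?y \<in> F" "?y - x \<in> F" using subspace_F x y by (auto intro: subspace_diff)
    have z: "\<eta> (x - ?y) = 0 \<and> \<eta> (?y - x) = 0" if "\<eta> \<in> ?D" for \<eta>
      using eq[OF that] DK that x y K_diff[of \<eta> x ?y] K_diff[of \<eta> ?y x] by (simp add: subset_iff)
    have "x - ?y = 0"
    proof (rule S_separating)
      show "x - ?y \<in> W" using d(1) by (rule F_W)
      fix \<phi> assume \<phi>: "\<phi> \<in> S"
      have "\<phi> (x - ?y) \<le> 0" "\<phi> (?y - x) \<le> 0"
        by (rule nonpos[OF d(1) _ \<phi>] nonpos[OF d(2) _ \<phi>], metis z order_refl)+
      then show "\<phi> (x - ?y) = 0"
        by (simp add: linear_diff[OF S_linear[OF \<phi>]])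
    qed
    then show ?thesis by simp
  qed
  moreover have "\<omega> (G \<omega>) = 1" if "\<omega> \<in> ?D" for \<omega> using dual[OF that that] by simp
  ultimately show ?thesis
    using finite_mult_states DK G by (intro exI[of _ ?D] exI[of _ G]) blast
qed

end

section \<open>Quadratic forms and positive arrays\<close>

definition quad :: "nat \<Rightarrow> (nat \<Rightarrow> nat \<Rightarrow> complex) \<Rightarrow> (nat \<Rightarrow> complex) \<Rightarrow> complex" where
  "quad n A v = (\<Sum>i<n. \<Sum>j<n. cnj (v i) * A i j * v j)"

text \<open>The complex order makes \<open>0 \<le> z\<close> include \<open>Im z = 0\<close>, so
  hermiticity is built in.\<close>

definition psd :: "nat \<Rightarrow> (nat \<Rightarrow> nat \<Rightarrow> complex) \<Rightarrow> bool" where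
  "psd n A \<longleftrightarrow> (\<forall>v. 0 \<le> quad n A v)"

definition norm2 :: "nat \<Rightarrow> (nat \<Rightarrow> complex) \<Rightarrow> real" where
  "norm2 n v = (\<Sum>i<n. (cmod (v i))\<^sup>2)"

lemma positive_op_iff: "positive_op n M \<longleftrightarrow> M \<in> carrier_mat n n \<and> psd n (\<lambda>i j. M $$ (i, j))"
  by (auto simp: positive_op_def psd_def quad_def Let_def less_eq_complex_def)

lemma quad_cong:
  "(\<And>i j. i < n \<Longrightarrow> j < n \<Longrightarrow> A i j = B i j) \<Longrightarrow> (\<And>i. i < n \<Longrightarrow> v i = w i) \<Longrightarrow> quad n A v = quad n B w"
  unfolding quad_def by (intro sum.cong refl) simp

lemma psd_cong: "(\<And>i j. i < n \<Longrightarrow> j < n \<Longrightarrow> A i j = B i j) \<Longrightarrow> psd n A \<longleftrightarrow> psd n B"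
  unfolding psd_def using quad_cong[of n A B] by metis

lemma quad_add: "quad n (\<lambda>i j. A i j + B i j) v = quad n A v + quad n B v"
  by (simp add: quad_def sum.distrib algebra_simps)

lemma quad_diff: "quad n (\<lambda>i j. A i j - B i j) v = quad n A v - quad n B v"
  by (simp add: quad_def sum_subtractf algebra_simps)

lemma quad_scale: "quad n (\<lambda>i j. c * A i j) v = c * quad n A v"
  by (simp add: quad_def sum_distrib_left mult_ac)

lemma quad_sum: "quad n (\<lambda>i j. \<Sum>l\<in>L. A l i j) v = (\<Sum>l\<in>L. quad n (A l) v)"
proof -
  have "quad n (\<lambda>i j. \<Sum>l\<in>L. A l i j) v = (\<Sum>i<n. \<Sum>j<n. \<Sum>l\<in>L. cnj (v i) * A l i j * v j)"
    by (simp add: quad_def sum_distrib_left sum_distrib_right)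
  also have "\<dots> = (\<Sum>i<n. \<Sum>l\<in>L. \<Sum>j<n. cnj (v i) * A l i j * v j)"
    by (intro sum.cong refl sum.swap)
  also have "\<dots> = (\<Sum>l\<in>L. quad n (A l) v)"
    unfolding quad_def by (rule sum.swap)
  finally show ?thesis .
qed

lemma quad_scale_vec: "quad n A (\<lambda>i. c * v i) = (cmod c)\<^sup>2 * quad n A v"
  by (simp add: quad_def sum_distrib_left complex_norm_square mult_ac del: of_real_power)

lemma quad_one: "quad n (\<lambda>i j. if i = j then 1 else 0) v = norm2 n v"
proof -
  have "quad n (\<lambda>i j. if i = j then 1 else 0) v = (\<Sum>i<n. \<Sum>j<n. if i = j then cnj (v i) * v j else 0)"
    unfolding quad_def by (intro sum.cong refl) simp
  also have "\<dots> = (\<Sum>i<n. cnj (v i) * v i)" by simp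
  finally show ?thesis
    by (simp add: norm2_def complex_norm_square mult_ac del: of_real_power)
qed

lemma quad_pair:
  assumes "a < n" "b < n" "a \<noteq> b"
  shows "quad n A (\<lambda>k. if k = a then s else if k = b then t else 0) =
    cnj s * A a a * s + cnj s * A a b * t + cnj t * A b a * s + cnj t * A b b * t"
proof -
  let ?v = "\<lambda>k. if k = a then s else if k = b then t else 0"
  have red: "(\<Sum>i<n. f i) = f a + f b" if "\<And>i. i \<noteq> a \<Longrightarrow> i \<noteq> b \<Longrightarrow> f i = 0" for f :: "nat \<Rightarrow> complex"
  proof -
    have "(\<Sum>i<n. f i) = (\<Sum>i\<in>{a, b}. f i)"
      using assms that by (intro sum.mono_neutral_right) auto
    then show ?thesis using assms by simp
  qed
  have "quad n A ?v = (\<Sum>i<n. cnj (?v i) * A i a * s + cnj (?v i) * A i b * t)"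
    unfolding quad_def using assms by (intro sum.cong refl, subst red) auto
  also have "\<dots> = cnj s * A a a * s + cnj s * A a b * t + cnj t * A b a * s + cnj t * A b b * t"
    using assms by (subst red) auto
  finally show ?thesis .
qed

lemma quad_single:
  assumes "a < n"
  shows "quad n A (\<lambda>k. if k = a then s else 0) = cnj s * A a a * s"
proof -
  have "quad n A (\<lambda>k. if k = a then s else 0) = (\<Sum>i<n. \<Sum>j<n. if i = a \<and> j = a then cnj s * A a a * s else 0)"
    unfolding quad_def by (intro sum.cong refl) auto
  also have "\<dots> = (\<Sum>i<n. if i = a then cnj s * A a a * s else 0)"
    using assms by (intro sum.cong refl) auto
  finally show ?thesis using assms by simp
qed

text \<open>Polarisation: the vectors \<open>e_i + e_j\<close> and \<open>e_i + \<i> e_j\<close>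
  give the sum and the difference of the two off-diagonal entries.\<close>

lemma quad_zero_imp_zero:
  assumes "\<And>v. quad n A v = 0" and ij: "i < n" "j < n"
  shows "A i j = 0"
proof (cases "i = j")
  case True
  then show ?thesis using assms(1)[of "\<lambda>k. if k = i then 1 else 0"] quad_single[OF ij(1), of A 1] by simp
next
  case False
  have d: "A k k = 0" if "k < n" for k
    using assms(1)[of "\<lambda>l. if l = k then 1 else 0"] quad_single[OF that, of A 1] by simp
  have "A i j + A j i = 0"
    using assms(1) quad_pair[OF ij False, of A 1 1] d ij by simp
  moreover have "A i j * \<i> - \<i> * A j i = 0"
    using assms(1) quad_pair[OF ij False, of A 1 \<i>] d ij by simp
  then have "A i j - A j i = 0" by (simp add: algebra_simps)
  ultimately show ?thesis by (simp add: complex_eq_iff)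
qed

lemma cnj_quad: "cnj (quad n A v) = quad n (\<lambda>i j. cnj (A j i)) v"
  unfolding quad_def cnj_sum by (subst sum.swap) (simp add: mult_ac)

text \<open>The form of \<open>A\<close> minus its adjoint is \<open>q - cnj q\<close>, which
  vanishes for real \<open>q\<close>, and polarisation applies.\<close>

lemma quad_real_imp_hermitian:
  assumes "\<And>v. Im (quad n A v) = 0" and ij: "i < n" "j < n"
  shows "A j i = cnj (A i j)"
proof -
  have "quad n (\<lambda>i j. A i j - cnj (A j i)) v = 0" for v
    unfolding quad_diff cnj_quad[symmetric] using assms(1)[of v] by (simp add: complex_eq_iff)
  from quad_zero_imp_zero[OF this ij(2,1)] show ?thesis by simp
qed

lemma psd_hermitian: "psd n A \<Longrightarrow> i < n \<Longrightarrow> j < n \<Longrightarrow> A j i = cnj (A i j)"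
  by (rule quad_real_imp_hermitian) (auto simp: psd_def less_eq_complex_def)

lemma psd_diag: "psd n A \<Longrightarrow> i < n \<Longrightarrow> 0 \<le> A i i"
  using quad_single[of i n A 1] by (auto simp: psd_def dest: spec[of _ "\<lambda>k. if k = i then 1 else 0"])

lemma psd_zero_diag:
  assumes A: "psd n A" and ij: "i < n" "j < n" and z: "A i i = 0"
  shows "A i j = 0"
proof (cases "i = j")
  case False
  define c where "c = Re (A j j)"
  have Ajj: "A j j = of_real c" "0 \<le> c"
    using psd_diag[OF A ij(2)] by (auto simp: c_def complex_eq_iff less_eq_complex_def)
  have h: "A j i = cnj (A i j)" using psd_hermitian[OF A ij] .
  let ?m = "(cmod (A i j))\<^sup>2"
  have m: "A i j * cnj (A i j) = of_real ?m"
    by (simp add: complex_norm_square del: of_real_power)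
  \<comment> \<open>The test vector \<open>-k A_ij e_i + e_j\<close> makes the cross terms
    \<open>-2 k |A_ij|^2\<close>; with \<open>A_ii = 0\<close> no quadratic term in \<open>k\<close>
    compensates them.\<close>
  have "0 \<le> real k * (- (2 * ?m)) + c" for k
  proof -
    have "0 \<le> quad n A (\<lambda>l. if l = i then - of_nat k * A i j else if l = j then 1 else 0)"
      using A by (simp add: psd_def)
    also have "\<dots> = - of_nat k * (cnj (A i j) * A i j) + - of_nat k * (A i j * cnj (A i j)) + of_real c"
      unfolding quad_pair[OF ij False] z h Ajj by simp
    also have "\<dots> = of_real (real k * (- (2 * ?m)) + c)"
      unfolding mult.commute[of "cnj (A i j)"] m by (simp add: algebra_simps)
    finally show ?thesis by (simp add: less_eq_complex_def)
  qed
  then have "- c \<le> real k * (- (2 * ?m))" for k by (simp add: algebra_simps)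
  then have "0 \<le> - (2 * ?m)" by (rule nonneg_if_multiples_bounded)
  then show ?thesis by simp
qed (use z in simp)

text \<open>Cholesky: subtracting from \<open>A\<close> the Schur complement term of a nonzero diagonal entry keeps
  positivity and kills that entry.\<close>

lemma psd_decomposition:
  assumes "psd n A"
  shows "\<exists>r W. \<forall>i<n. \<forall>j<n. A i j = (\<Sum>k<r::nat. W k i * cnj (W k j))"
  using assms
proof (induction "card {i. i < n \<and> A i i \<noteq> 0}" arbitrary: A rule: less_induct)
  case less
  show ?case
  proof (cases "\<exists>p<n. A p p \<noteq> 0")
    case False
    then have "A i j = 0" if "i < n" "j < n" for i j
      using psd_zero_diag[OF less.prems that] that by blast
    then show ?thesis by (intro exI[of _ 0]) simp
  next
    case True
    then obtain p where p: "p < n" "A p p \<noteq> 0" by blast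
    define a where "a = Re (A p p)"
    have App: "A p p = of_real a" and a: "0 < a"
      using psd_diag[OF less.prems p(1)] p(2) by (auto simp: a_def complex_eq_iff less_eq_complex_def)
    have herm: "A j i = cnj (A i j)" if "i < n" "j < n" for i j
      using psd_hermitian[OF less.prems that] .
    define B where "B i j = A i j - A i p * A p j / a" for i j
    have "0 \<le> quad n B v" for v
    proof -
      \<comment> \<open>Completing the square: the form of \<open>B\<close> at \<open>v\<close> is
        the form of \<open>A\<close> at \<open>v - t e_p\<close>, with \<open>t = s / a\<close> the
        minimising shift.\<close>
      define s where "s = (\<Sum>j<n. A p j * v j)"
      define t where "t = s / of_real a"
      have s: "s = a * t" using a by (simp add: t_def)
      have s': "(\<Sum>i<n. cnj (v i) * A i p) = cnj s"
        unfolding s_def cnj_sum by (intro sum.cong refl) (simp add: herm[OF p(1)] mult.commute)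
      have r: "quad n (\<lambda>i j. A i p * A p j / a) v = cnj s * s / a"
      proof -
        have "quad n (\<lambda>i j. A i p * A p j / a) v = (\<Sum>i<n. \<Sum>j<n. (cnj (v i) * A i p) * (A p j * v j)) / a"
          by (simp add: quad_def sum_divide_distrib mult_ac)
        then show ?thesis by (simp add: sum_product[symmetric] s' s_def[symmetric])
      qed
      define e where "e i = (if i = p then 1 else 0 :: complex)" for i
      have e_sum: "(\<Sum>i<n. e i * f i) = f p" "(\<Sum>i<n. f i * e i) = f p" for f
        using p(1) by (simp_all add: e_def if_distrib if_distribR cong: if_cong)
      have cnje: "cnj (e i) = e i" for i by (simp add: e_def)
      have pointwise: "cnj (v i - t * e i) * A i j * (v j - t * e j) = cnj (v i) * A i j * v j
          - t * (cnj (v i) * (A i j * e j)) - cnj t * (e i * (A i j * v j))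
          + cnj t * t * (e i * (A i j * e j))" for i j
        unfolding complex_cnj_diff complex_cnj_mult cnje by (simp add: algebra_simps)
      have x: "(\<Sum>i<n. \<Sum>j<n. t * (cnj (v i) * (A i j * e j))) = t * cnj s"
        by (simp only: sum_distrib_left[symmetric] e_sum s')
      have y: "(\<Sum>i<n. \<Sum>j<n. cnj t * (e i * (A i j * v j))) = cnj t * s"
        by (simp only: sum_distrib_left[symmetric] e_sum s_def)
      have z: "(\<Sum>i<n. \<Sum>j<n. cnj t * t * (e i * (A i j * e j))) = cnj t * t * a"
        by (simp only: sum_distrib_left[symmetric] e_sum App)
      have "quad n A (\<lambda>i. v i - t * e i) = quad n A v - t * cnj s - cnj t * s + cnj t * t * a"
        unfolding quad_def pointwise by (simp only: sum.distrib sum_subtractf x y z)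
      also have "\<dots> = quad n B v"
        using a unfolding B_def[abs_def] quad_diff r s by (simp add: algebra_simps)
      finally show ?thesis using less.prems by (metis psd_def)
    qed
    then have B: "psd n B" by (simp add: psd_def)
    \<comment> \<open>Diagonal zeros survive because positivity kills their whole row; together with
      the new zero at \<open>p\<close> the induction measure drops.\<close>
    have Bdiag: "B i i = 0" if "i < n" "A i i = 0" for i
    proof -
      have "A i p = 0" using psd_zero_diag[OF less.prems that(1) p(1)] that(2) .
      then show ?thesis using that by (simp add: B_def)
    qed
    have "B p p = 0" using a by (simp add: B_def App)
    then have "{i. i < n \<and> B i i \<noteq> 0} \<subset> {i. i < n \<and> A i i \<noteq> 0}"
      using Bdiag p by blast
    then have "card {i. i < n \<and> B i i \<noteq> 0} < card {i. i < n \<and> A i i \<noteq> 0}"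
      by (intro psubset_card_mono) auto
    from less.hyps[OF this B] obtain r W where
      W: "\<And>i j. i < n \<Longrightarrow> j < n \<Longrightarrow> B i j = (\<Sum>k<r::nat. W k i * cnj (W k j))" by blast
    \<comment> \<open>The subtracted Schur term is itself of rank one; it is appended at index
      \<open>r\<close>, with \<open>sqrt a\<close> splitting the factor \<open>1 / a\<close>
      evenly.\<close>
    define V where "V k i = (if k = r then A i p / of_real (sqrt a) else W k i)" for k i
    have sq: "complex_of_real (sqrt a) * of_real (sqrt a) = of_real a"
      using a by (simp flip: of_real_mult)
    have "A i j = (\<Sum>k<Suc r. V k i * cnj (V k j))" if "i < n" "j < n" for i j
    proof -
      have "(\<Sum>k<r. V k i * cnj (V k j)) = (\<Sum>k<r. W k i * cnj (W k j))"
        by (intro sum.cong) (auto simp: V_def)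
      moreover have "V r i * cnj (V r j) = A i p * A p j / a"
        using herm[OF that(2) p(1)] by (simp add: V_def sq)
      moreover have "A i j = B i j + A i p * A p j / a" by (simp add: B_def)
      ultimately show ?thesis using W[OF that] by simp
    qed
    then show ?thesis by (intro exI[of _ "Suc r"] exI[of _ V]) simp
  qed
qed

section \<open>The trace pairing and reduction to unit vectors\<close>

definition pairing :: "nat \<Rightarrow> (nat \<Rightarrow> nat \<Rightarrow> complex) \<Rightarrow> (nat \<Rightarrow> nat \<Rightarrow> complex) \<Rightarrow> complex" where
  "pairing n A B = (\<Sum>i<n. \<Sum>j<n. A i j * B j i)"

lemma pairing_rank_one_sum:
  assumes "\<And>i j. i < n \<Longrightarrow> j < n \<Longrightarrow> B i j = (\<Sum>k<r::nat. W k i * cnj (W k j))"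
  shows "pairing n A B = (\<Sum>k<r. quad n A (W k))"
proof -
  have "pairing n A B = (\<Sum>i<n. \<Sum>j<n. \<Sum>k<r. cnj (W k i) * A i j * W k j)"
    unfolding pairing_def
    by (intro sum.cong refl) (simp add: assms sum_distrib_left sum_distrib_right mult_ac)
  also have "\<dots> = (\<Sum>i<n. \<Sum>k<r. \<Sum>j<n. cnj (W k i) * A i j * W k j)"
    by (intro sum.cong refl sum.swap)
  also have "\<dots> = (\<Sum>k<r. quad n A (W k))"
    unfolding quad_def by (rule sum.swap)
  finally show ?thesis .
qed

text \<open>Decomposing only \<open>B\<close> into rank-one terms turns the trace of the product
  into a sum of values of the form of \<open>A\<close>.\<close>

lemma pairing_nonneg: "psd n A \<Longrightarrow> psd n B \<Longrightarrow> 0 \<le> pairing n A B"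
proof -
  assume A: "psd n A" and B: "psd n B"
  obtain r W where "\<forall>i<n. \<forall>j<n. B i j = (\<Sum>k<r::nat. W k i * cnj (W k j))"
    using psd_decomposition[OF B] by blast
  then have "pairing n A B = (\<Sum>k<r. quad n A (W k))"
    by (intro pairing_rank_one_sum) blast
  then show ?thesis using A by (auto simp: psd_def intro: sum_nonneg)
qed

lemma norm2_nonneg: "0 \<le> norm2 n v"
  by (simp add: norm2_def sum_nonneg)

lemma norm2_scale: "norm2 n (\<lambda>i. c * v i) = (cmod c)\<^sup>2 * norm2 n v"
  by (simp add: norm2_def norm_mult power_mult_distrib sum_distrib_left)

lemma norm2_eq_0: "norm2 n v = 0 \<longleftrightarrow> (\<forall>i<n. v i = 0)"
  by (auto simp: norm2_def sum_nonneg_eq_0_iff)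

lemma unit_vector_component_le:
  assumes "norm2 d v = 1" "i < d"
  shows "cmod (v i) \<le> 1"
proof -
  have "(cmod (v i))\<^sup>2 \<le> norm2 d v"
    unfolding norm2_def using assms(2) by (intro member_le_sum) auto
  then show ?thesis using assms(1) by (simp add: power_le_one_iff abs_square_le_1)
qed

text \<open>One unit vector \<open>w\<close> serves all \<open>A\<close> simultaneously. If
  \<open>v\<close> vanishes below \<open>n\<close>, the factor is 0 and a basis vector does, which
  is where \<open>0 < n\<close> enters.\<close>

lemma unit_vector_reduction:
  assumes "0 < n"
  shows "\<exists>w. norm2 n w = 1 \<and> (\<forall>A. quad n A v = of_real (norm2 n v) * quad n A w)"
proof (cases "norm2 n v = 0")
  case True
  then have "quad n A v = 0" for A
    unfolding quad_def by (intro sum.neutral ballI) (simp add: norm2_eq_0)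
  moreover have "norm2 n (\<lambda>i. if i = 0 then 1 else 0) = 1"
    using assms by (simp add: norm2_def if_distrib[of cmod] if_distrib[of "\<lambda>x. x ^ 2"] cong: if_cong)
  ultimately show ?thesis using True by auto
next
  case False
  then have N: "0 < norm2 n v" using norm2_nonneg[of n v] by simp
  let ?c = "complex_of_real (1 / sqrt (norm2 n v))"
  have "(cmod ?c)\<^sup>2 = 1 / norm2 n v" using N by (simp add: norm_divide power_divide)
  then have c: "(cmod ?c)\<^sup>2 * norm2 n v = 1" using N by simp
  then have "complex_of_real (norm2 n v) * of_real ((cmod ?c)\<^sup>2) = 1"
    by (metis mult.commute of_real_1 of_real_mult)
  then have "quad n A v = of_real (norm2 n v) * quad n A (\<lambda>i. ?c * v i)" for A
    unfolding quad_scale_vec mult.assoc[symmetric] by simp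
  with c show ?thesis
    by (intro exI[of _ "\<lambda>i. ?c * v i"] conjI allI) (simp only: norm2_scale)
qed

section \<open>Operators, states and measure-and-prepare channels\<close>

abbreviation entries :: "complex mat \<Rightarrow> nat \<Rightarrow> nat \<Rightarrow> complex" where
  "entries A \<equiv> \<lambda>i j. A $$ (i, j)"

lemma psd_sum: "(\<And>l. l \<in> L \<Longrightarrow> psd n (A l)) \<Longrightarrow> psd n (\<lambda>i j. \<Sum>l\<in>L. A l i j)"
  unfolding psd_def quad_sum by (auto intro: sum_nonneg)

lemma psd_rank_one: "psd n (\<lambda>i j. w i * cnj (w j))"
  unfolding psd_def
proof
  fix v
  let ?s = "\<Sum>i<n. cnj (v i) * w i"
  have "quad n (\<lambda>i j. w i * cnj (w j)) v = (\<Sum>i<n. \<Sum>j<n. (cnj (v i) * w i) * cnj (cnj (v j) * w j))"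
    by (simp add: quad_def mult_ac)
  also have "\<dots> = ?s * cnj ?s" by (simp only: sum_product cnj_sum)
  also have "\<dots> = of_real ((cmod ?s)\<^sup>2)" by (simp add: complex_norm_square del: of_real_power)
  also have "0 \<le> \<dots>" by (simp add: less_eq_complex_def del: of_real_power)
  finally show "0 \<le> quad n (\<lambda>i j. w i * cnj (w j)) v" .
qed

lemma psd_real: "psd n A \<Longrightarrow> quad n A v = of_real (Re (quad n A v))"
  by (simp add: psd_def less_eq_complex_def complex_eq_iff)

lemma norm2_expand_diff:
  fixes w v :: "nat \<Rightarrow> complex" and c :: real
  shows "norm2 n (\<lambda>i. w i - c * v i) = norm2 n w - 2 * c * Re (\<Sum>i<n. cnj (v i) * w i) + c\<^sup>2 * norm2 n v"
proof -
  have "(cmod (w i - c * v i))\<^sup>2 = (cmod (w i))\<^sup>2 - 2 * c * Re (cnj (v i) * w i) + c\<^sup>2 * (cmod (v i))\<^sup>2" for i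
    unfolding cmod_power2 by (simp add: power2_eq_square algebra_simps)
  then show ?thesis
    by (simp only: norm2_def sum.distrib sum_subtractf sum_distrib_left[symmetric] Re_sum)
qed

text \<open>Evaluating the form of \<open>A \<ge> 0\<close> at \<open>A v - c v\<close> bounds \<open>|A v|\<close> without Cauchy-Schwarz.\<close>

lemma psd_norm2_apply_le:
  assumes A: "psd n A" and c: "0 \<le> c" and le: "\<And>v. Re (quad n A v) \<le> c * norm2 n v"
  shows "norm2 n (\<lambda>i. \<Sum>j<n. A i j * v j) \<le> c\<^sup>2 * norm2 n v"
proof -
  define w where "w i = (\<Sum>j<n. A i j * v j)" for i
  have herm: "A j i = cnj (A i j)" if "i < n" "j < n" for i j
    using psd_hermitian[OF A that] .
  have N: "(\<Sum>i<n. cnj (w i) * w i) = norm2 n w"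
    by (simp add: norm2_def complex_norm_square mult_ac del: of_real_power)
  have wv: "(\<Sum>i<n. \<Sum>j<n. cnj (w i) * A i j * v j) = norm2 n w"
    unfolding N[symmetric] by (simp only: mult.assoc sum_distrib_left[symmetric] w_def[symmetric])
  have "cnj (\<Sum>i<n. \<Sum>j<n. cnj (w i) * A i j * v j) = (\<Sum>i<n. \<Sum>j<n. cnj (v j) * A j i * w i)"
    unfolding cnj_sum
  proof (intro sum.cong refl)
    fix i j assume "i \<in> {..<n}" "j \<in> {..<n}"
    then show "cnj (cnj (w i) * A i j * v j) = cnj (v j) * A j i * w i"
      using herm[of i j] by (simp add: mult_ac)
  qed
  then have vw: "(\<Sum>i<n. \<Sum>j<n. cnj (v i) * A i j * w j) = norm2 n w"
    unfolding wv by (subst sum.swap) simp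
  have expand: "quad n A (\<lambda>i. w i - t * v i) = quad n A w - 2 * t * norm2 n w + t\<^sup>2 * quad n A v" for t :: real
  proof -
    have "quad n A (\<lambda>i. w i - t * v i) = (\<Sum>i<n. \<Sum>j<n. cnj (w i) * A i j * w j - t * (cnj (w i) * A i j * v j)
      - t * (cnj (v i) * A i j * w j) + t\<^sup>2 * (cnj (v i) * A i j * v j))"
      unfolding quad_def by (intro sum.cong refl) (simp add: algebra_simps power2_eq_square)
    also have "\<dots> = quad n A w - t * norm2 n w - t * norm2 n w + t\<^sup>2 * quad n A v"
      by (simp only: sum.distrib sum_subtractf sum_distrib_left[symmetric] wv vw quad_def of_real_mult)
    finally show ?thesis by (simp add: algebra_simps)
  qed
  \<comment> \<open>Since \<open>w = A v\<close>, both cross terms equal \<open>norm2 n w\<close>.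
    The choice \<open>t = c\<close> gives the bound after division by \<open>c\<close>; for
    \<open>c = 0\<close> the choice \<open>t = 1\<close> forces \<open>w\<close> to vanish.\<close>
  have nn: "0 \<le> Re (quad n A w) - 2 * t * norm2 n w + t\<^sup>2 * Re (quad n A v)" for t
  proof -
    have "0 \<le> Re (quad n A (\<lambda>i. w i - t * v i))"
      using A by (simp add: psd_def less_eq_complex_def)
    then show ?thesis unfolding expand by (simp flip: of_real_power)
  qed
  have "norm2 n w \<le> c\<^sup>2 * norm2 n v"
  proof (cases "c = 0")
    case True
    have "0 \<le> - 2 * norm2 n w" using nn[of 1] le[of w] le[of v] True by simp
    then show ?thesis using True by simp
  next
    case False
    have "c\<^sup>2 * Re (quad n A v) \<le> c\<^sup>2 * (c * norm2 n v)"
      using le[of v] by (intro mult_left_mono) auto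
    then have "c * norm2 n w \<le> c * (c\<^sup>2 * norm2 n v)"
      using nn[of c] le[of w] by (simp add: algebra_simps)
    then show ?thesis using False c by simp
  qed
  then show ?thesis by (simp add: w_def[abs_def])
qed

section \<open>Operator norm of positive operators\<close>

text \<open>A compact box containing the unit disc; it confines the coordinates of unit
  vectors.\<close>

definition unit_square :: "complex set" where
  "unit_square = (\<lambda>(x, y). Complex x y) ` ({-1..1} \<times> {-1..1})"

lemma compact_unit_square: "compact unit_square"
  unfolding unit_square_def case_prod_beta Complex_eq
  by (intro compact_continuous_image continuous_intros compact_Times compact_Icc)

lemma cmod_le_1_unit_square: "cmod z \<le> 1 \<Longrightarrow> z \<in> unit_square"
  using abs_Re_le_cmod[of z] abs_Im_le_cmod[of z] unfolding unit_square_def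
  by (intro image_eqI[of _ _ "(Re z, Im z)"]) (auto simp: abs_le_iff)

text \<open>For positive operators the norm is the maximum of the quadratic form, attained on the
  compact unit sphere. This links the \<open>Sup\<close> over \<open>|M v|\<close> to expectation
  values, used everywhere else.\<close>

lemma op_norm_attained:
  assumes d: "0 < d" and M: "positive_op d M"
  shows "\<exists>\<psi>. norm2 d \<psi> = 1 \<and> quad d (entries M) \<psi> = of_real (op_norm d M) \<and>
    (\<forall>v. Re (quad d (entries M) v) \<le> op_norm d M * norm2 d v)"
proof -
  let ?A = "entries M"
  have psd: "psd d ?A" using M by (simp add: positive_op_iff)
  \<comment> \<open>Vectors are functions on all naturals; pinning the coordinates from
    \<open>d\<close> on to 0 makes the sphere compact in the product topology.\<close>
  define U where "U = PiE UNIV (\<lambda>i::nat. if i < d then unit_square else {0}) \<inter> {v. norm2 d v = 1}"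
  have "compactin (product_topology (\<lambda>_. euclidean) UNIV)
      (PiE UNIV (\<lambda>i::nat. if i < d then unit_square else {0}))"
    unfolding compactin_PiE by (simp add: compact_unit_square)
  then have "compact (PiE UNIV (\<lambda>i::nat. if i < d then unit_square else {0}))"
    by (simp add: euclidean_product_topology)
  moreover have ev: "continuous_on A (\<lambda>v. v i :: complex)" for A and i :: nat
    by (rule continuous_on_subset[of UNIV]) auto
  have "closed {v. norm2 d v = 1}"
    unfolding norm2_def
    by (intro closed_Collect_eq continuous_on_sum continuous_on_power continuous_on_norm ev continuous_on_const)
  ultimately have U: "compact U" unfolding U_def by (rule compact_Int_closed)
  have "(\<lambda>i. if i = 0 then 1 else 0) \<in> U"
    using d by (auto intro!: cmod_le_1_unit_square simp: U_def norm2_def PiE_def if_distrib[of cmod] if_distrib[of "\<lambda>x. x ^ 2"] cong: if_cong)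
  then have U_ne: "U \<noteq> {}" by blast
  have "continuous_on U (\<lambda>v. Re (quad d ?A v))"
    unfolding quad_def by (intro continuous_intros ev)
  from continuous_attains_sup[OF U U_ne this] obtain \<psi> where
    \<psi>: "\<psi> \<in> U" and max: "\<And>v. v \<in> U \<Longrightarrow> Re (quad d ?A v) \<le> Re (quad d ?A \<psi>)"
    by blast
  define c where "c = Re (quad d ?A \<psi>)"
  have c: "0 \<le> c" using psd by (simp add: c_def psd_def less_eq_complex_def)
  have n\<psi>: "norm2 d \<psi> = 1" using \<psi> by (simp add: U_def)
  have le: "Re (quad d ?A v) \<le> c * norm2 d v" for v
  proof -
    obtain w where w: "norm2 d w = 1" "\<And>A. quad d A v = of_real (norm2 d v) * quad d A w"
      using unit_vector_reduction[OF d] by blast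
    let ?w = "\<lambda>i. if i < d then w i else 0"
    have n: "norm2 d ?w = 1" using w(1) by (simp add: norm2_def)
    have "cmod (w i) \<le> 1" if "i < d" for i
      using w(1) that by (rule unit_vector_component_le)
    then have "?w \<in> U" using n by (auto intro!: cmod_le_1_unit_square simp: U_def PiE_def)
    then have "Re (quad d ?A ?w) \<le> c" unfolding c_def by (rule max)
    moreover have "quad d ?A ?w = quad d ?A w" by (intro quad_cong) auto
    ultimately have "Re (quad d ?A w) \<le> c" by simp
    from mult_left_mono[OF this norm2_nonneg[of d v]] show ?thesis
      by (simp add: w(2)[of ?A] mult.commute)
  qed
  have N: "norm2 d (\<lambda>i. \<Sum>j<d. ?A i j * v j) \<le> c\<^sup>2 * norm2 d v" for v
    using psd_norm2_apply_le[OF psd c le] .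
  let ?w = "\<lambda>i. \<Sum>j<d. ?A i j * \<psi> j"
  have "(\<Sum>i<d. cnj (\<psi> i) * ?w i) = quad d ?A \<psi>"
    by (simp add: quad_def sum_distrib_left mult_ac)
  \<comment> \<open>Expanding \<open>|A \<psi> - c \<psi>|^2 \<ge> 0\<close> with expectation
    \<open>c\<close> gives \<open>|A \<psi>| \<ge> c\<close>, the converse of the bound
    \<open>N\<close>.\<close>
  then have "0 \<le> norm2 d ?w - 2 * c * c + c\<^sup>2 * norm2 d \<psi>"
    using norm2_nonneg[of d "\<lambda>i. ?w i - c * \<psi> i"] unfolding norm2_expand_diff by (simp add: c_def)
  then have "c\<^sup>2 \<le> norm2 d ?w" using n\<psi> by (simp add: power2_eq_square)
  then have "norm2 d ?w = c\<^sup>2" using N[of \<psi>] n\<psi> by simp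
  then have att: "sqrt (norm2 d ?w) = c" using c by simp
  have "op_norm d M = Sup {sqrt (norm2 d (\<lambda>i. \<Sum>j<d. M $$ (i, j) * v j)) | v. norm2 d v \<le> 1}"
    by (simp add: op_norm_def norm2_def)
  also have "\<dots> = c"
  proof (rule cSup_eq_maximum)
    show "c \<in> {sqrt (norm2 d (\<lambda>i. \<Sum>j<d. M $$ (i, j) * v j)) | v. norm2 d v \<le> 1}"
      using att n\<psi> by (intro CollectI exI[of _ \<psi>]) simp
    fix x assume "x \<in> {sqrt (norm2 d (\<lambda>i. \<Sum>j<d. M $$ (i, j) * v j)) | v. norm2 d v \<le> 1}"
    then obtain v where v: "x = sqrt (norm2 d (\<lambda>i. \<Sum>j<d. M $$ (i, j) * v j))" "norm2 d v \<le> 1" by blast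
    have "norm2 d (\<lambda>i. \<Sum>j<d. M $$ (i, j) * v j) \<le> c\<^sup>2 * 1"
      using N[of v] mult_left_mono[OF v(2), of "c\<^sup>2"] by simp
    then show "x \<le> c" unfolding v(1) using c by (simp add: real_le_lsqrt)
  qed
  finally have "op_norm d M = c" .
  moreover have "quad d ?A \<psi> = of_real c" using psd_real[OF psd] by (simp add: c_def)
  ultimately show ?thesis using n\<psi> le by blast
qed

section \<open>Traces, rank-one operators and POVM sums\<close>

lemma mtrace_mult:
  assumes "A \<in> carrier_mat n n" "B \<in> carrier_mat n n"
  shows "mtrace (A * B) = pairing n (entries A) (entries B)"
  using assms by (simp add: mtrace_def pairing_def scalar_prod_def lessThan_atLeast0)

lemma pairing_commute: "pairing n A B = pairing n B A"
  unfolding pairing_def by (subst sum.swap) (simp add: mult.commute)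

lemma pairing_sum_left: "pairing n (\<lambda>i j. \<Sum>l\<in>L. A l i j) B = (\<Sum>l\<in>L. pairing n (A l) B)"
proof -
  have "pairing n (\<lambda>i j. \<Sum>l\<in>L. A l i j) B = (\<Sum>i<n. \<Sum>j<n. \<Sum>l\<in>L. A l i j * B j i)"
    by (simp add: pairing_def sum_distrib_right)
  also have "\<dots> = (\<Sum>i<n. \<Sum>l\<in>L. \<Sum>j<n. A l i j * B j i)"
    by (intro sum.cong refl sum.swap)
  also have "\<dots> = (\<Sum>l\<in>L. pairing n (A l) B)"
    unfolding pairing_def by (rule sum.swap)
  finally show ?thesis .
qed

lemma pairing_scale_left: "pairing n (\<lambda>i j. c * A i j) B = c * pairing n A B"
  by (simp add: pairing_def sum_distrib_left mult_ac)

lemma pairing_cong: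
  "(\<And>i j. i < n \<Longrightarrow> j < n \<Longrightarrow> A i j = A' i j) \<Longrightarrow> (\<And>i j. i < n \<Longrightarrow> j < n \<Longrightarrow> B i j = B' i j) \<Longrightarrow>
    pairing n A B = pairing n A' B'"
  unfolding pairing_def by (intro sum.cong refl) simp

lemma pairing_one: "pairing n (\<lambda>i j. if i = j then 1 else 0) B = (\<Sum>i<n. B i i)"
proof -
  have "pairing n (\<lambda>i j. if i = j then 1 else 0) B = (\<Sum>i<n. \<Sum>j<n. if i = j then B j i else 0)"
    unfolding pairing_def by (intro sum.cong refl) simp
  then show ?thesis by simp
qed

lemma pairing_rank_one: "pairing n A (\<lambda>i j. v i * cnj (v j)) = quad n A v"
  using pairing_rank_one_sum[where n=n and r=1 and W="\<lambda>_. v" and A=A] by simp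

text \<open>The rank-one operator of an arbitrary vector, a projection when \<open>v\<close> has
  norm 1; unnormalised vectors occur in the duality formulas.\<close>

definition proj :: "nat \<Rightarrow> (nat \<Rightarrow> complex) \<Rightarrow> complex mat" where
  "proj d v = mat d d (\<lambda>(i, j). v i * cnj (v j))"

lemma proj_carrier: "proj d v \<in> carrier_mat d d"
  by (simp add: proj_def)

lemma pairing_proj: "pairing d A (entries (proj d v)) = quad d A v"
  unfolding pairing_rank_one[symmetric] by (intro pairing_cong) (auto simp: proj_def)

lemma proj_positive: "positive_op d (proj d v)"
proof -
  have "psd d (entries (proj d v)) \<longleftrightarrow> psd d (\<lambda>i j. v i * cnj (v j))"
    by (intro psd_cong) (auto simp: proj_def)
  then show ?thesis by (simp add: positive_op_iff psd_rank_one proj_carrier)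
qed

lemma mtrace_proj: "mtrace (proj d v) = norm2 d v"
  by (simp add: mtrace_def proj_def norm2_def complex_norm_square del: of_real_power)

lemma proj_state: "norm2 d v = 1 \<Longrightarrow> proj d v \<in> states d"
  by (simp add: states_def proj_positive mtrace_proj)

lemma mtrace_mult_proj: "A \<in> carrier_mat d d \<Longrightarrow> mtrace (A * proj d v) = quad d (entries A) v"
  by (simp add: mtrace_mult[OF _ proj_carrier] pairing_proj)

lemma mtrace_commute:
  assumes "A \<in> carrier_mat n n" "B \<in> carrier_mat n n"
  shows "mtrace (A * B) = mtrace (B * A)"
  by (simp add: mtrace_mult[OF assms] mtrace_mult[OF assms(2,1)] pairing_commute)

lemma positive_carrier: "positive_op n A \<Longrightarrow> A \<in> carrier_mat n n"
  by (simp add: positive_op_iff)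

lemma mtrace_entries: "A \<in> carrier_mat n n \<Longrightarrow> mtrace A = (\<Sum>i<n. A $$ (i, i))"
  by (auto simp: mtrace_def)

lemma povm_length:
  assumes "povm d G"
  shows "l < length G \<Longrightarrow> positive_op d (G ! l)"
    and "i < d \<Longrightarrow> j < d \<Longrightarrow> (\<Sum>l<length G. (G ! l) $$ (i, j)) = (if i = j then 1 else 0)"
proof -
  show "l < length G \<Longrightarrow> positive_op d (G ! l)" using assms by (simp add: povm_def)
  assume ij: "i < d" "j < d"
  have "msum d (\<lambda>k. G ! k) {..<length G} $$ (i, j) = 1\<^sub>m d $$ (i, j)"
    using assms by (simp add: povm_def)
  then show "(\<Sum>l<length G. (G ! l) $$ (i, j)) = (if i = j then 1 else 0)"
    using ij by (simp add: msum_def)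
qed

lemma povm_pairing_sum:
  assumes "povm d G"
  shows "(\<Sum>l<length G. pairing d (entries (G ! l)) B) = (\<Sum>i<d. B i i)"
  unfolding pairing_sum_left[symmetric] pairing_one[symmetric]
  by (intro pairing_cong) (auto simp: povm_length[OF assms])

lemma povm_quad_sum:
  assumes "povm d G"
  shows "(\<Sum>l<length G. quad d (entries (G ! l)) v) = norm2 d v"
  unfolding quad_sum[symmetric] quad_one[symmetric]
  by (intro quad_cong) (auto simp: povm_length[OF assms])

section \<open>Tensor indices and measure-and-prepare channels\<close>

lemma sum_product_index:
  fixes f :: "nat \<Rightarrow> 'a::comm_monoid_add"
  shows "(\<Sum>r<k * m. f r) = (\<Sum>a<k. \<Sum>p<m. f (a * m + p))"
proof -
  have "(\<Sum>r<k * m. f r) = (\<Sum>a<k. sum f {a * m..<a * m + m})"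
    by (rule sum.nat_group[symmetric])
  also have "\<dots> = (\<Sum>a<k. \<Sum>p<m. f (a * m + p))"
  proof (rule sum.cong[OF refl])
    fix a
    show "sum f {a * m..<a * m + m} = (\<Sum>p<m. f (a * m + p))"
      using sum.shift_bounds_nat_ivl[of f 0 "a * m" m] by (simp add: add.commute lessThan_atLeast0)
  qed
  finally show ?thesis .
qed

lemma quad_product_index:
  "quad (k * m) A v = (\<Sum>a<k. \<Sum>b<k. \<Sum>p<m. \<Sum>q<m. cnj (v (a * m + p)) * A (a * m + p) (b * m + q) * v (b * m + q))"
  unfolding quad_def sum_product_index
  by (rule sum.cong[OF refl], rule sum.swap)

lemma product_index_less: "a < k \<Longrightarrow> p < m \<Longrightarrow> a * m + p < k * (m::nat)"
proof -
  assume "a < k" "p < m"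
  then have "a * m + p < Suc a * m" by simp
  also have "\<dots> \<le> k * m" using \<open>a < k\<close> by (intro mult_right_mono) auto
  finally show ?thesis .
qed

lemma product_index_div_mod [simp]:
  "p < m \<Longrightarrow> (a * m + p) div m = (a::nat)" "p < m \<Longrightarrow> (a * m + p) mod m = p"
  by auto

text \<open>Taking \<open>L = 1\<close> gives a single instrument branch, taking all outcomes of a
  POVM gives a channel.\<close>

definition measure_prepare ::
  "nat \<Rightarrow> nat \<Rightarrow> nat \<Rightarrow> (nat \<Rightarrow> complex mat) \<Rightarrow> (nat \<Rightarrow> complex mat) \<Rightarrow> complex mat \<Rightarrow> complex mat" where
  "measure_prepare n m L G \<tau> X =
     mat m m (\<lambda>(p, q). \<Sum>l<L. pairing n (entries (G l)) (entries X) * \<tau> l $$ (p, q))"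

lemma measure_prepare_linear: "linear_map n m (measure_prepare n m L G \<tau>)"
  unfolding linear_map_def
proof (intro conjI ballI allI)
  fix X Y :: "complex mat" and c :: complex
  assume X: "X \<in> carrier_mat n n"
  show "measure_prepare n m L G \<tau> X \<in> carrier_mat m m" by (simp add: measure_prepare_def)
  have "pairing n A (entries (c \<cdot>\<^sub>m X)) = c * pairing n A (entries X)" for A
    using X by (simp add: pairing_def sum_distrib_left mult_ac)
  then show "measure_prepare n m L G \<tau> (c \<cdot>\<^sub>m X) = c \<cdot>\<^sub>m measure_prepare n m L G \<tau> X"
    by (intro eq_matI) (auto simp: measure_prepare_def sum_distrib_left mult_ac)
  assume Y: "Y \<in> carrier_mat n n"
  have "pairing n A (entries (X + Y)) = pairing n A (entries X) + pairing n A (entries Y)" for A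
    using X Y by (simp add: pairing_def sum.distrib algebra_simps)
  then show "measure_prepare n m L G \<tau> (X + Y) = measure_prepare n m L G \<tau> X + measure_prepare n m L G \<tau> Y"
    by (intro eq_matI) (auto simp: measure_prepare_def sum.distrib algebra_simps)
qed

text \<open>Contracting the output part of \<open>v\<close> with \<open>t\<close> leaves a vector
  \<open>\<beta>\<close> on the ancilla, and the form becomes that of \<open>X\<close> at the
  product vector \<open>\<beta> \<otimes> g\<close>.\<close>

lemma rank_one_ampliation_psd:
  assumes X: "psd (k * n) X"
  shows "psd (k * m) (\<lambda>r s. (\<Sum>i<n. \<Sum>j<n. cnj (g i) * X (r div m * n + i) (s div m * n + j) * g j) *
    (t (r mod m) * cnj (t (s mod m))))"
    (is "psd _ ?A")
  unfolding psd_def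
proof
  fix v
  define \<beta> where "\<beta> a = (\<Sum>q<m. cnj (t q) * v (a * m + q))" for a
  define z where "z r = g (r mod n) * \<beta> (r div n)" for r
  have \<beta>': "(\<Sum>p<m. cnj (v (a * m + p)) * t p) = cnj (\<beta> a)" for a
    by (simp add: \<beta>_def cnj_sum mult.commute)
  have "quad (k * m) ?A v = (\<Sum>a<k. \<Sum>b<k. \<Sum>p<m. \<Sum>q<m.
      (\<Sum>i<n. \<Sum>j<n. cnj (g i) * X (a * n + i) (b * n + j) * g j) *
      ((cnj (v (a * m + p)) * t p) * (cnj (t q) * v (b * m + q))))"
    unfolding quad_product_index by (intro sum.cong refl) (simp add: mult_ac)
  also have "\<dots> = (\<Sum>a<k. \<Sum>b<k.
      (\<Sum>i<n. \<Sum>j<n. cnj (g i) * X (a * n + i) (b * n + j) * g j) * (cnj (\<beta> a) * \<beta> b))"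
    by (simp only: sum_distrib_left[symmetric] sum_distrib_right[symmetric] \<beta>' \<beta>_def[symmetric])
  also have "\<dots> = quad (k * n) X z"
    unfolding quad_product_index
    by (intro sum.cong refl) (simp add: z_def sum_distrib_left sum_distrib_right mult_ac)
  finally show "0 \<le> quad (k * m) ?A v" using X by (simp add: psd_def)
qed

text \<open>Rank-one decompositions of each effect and each prepared operator split the ampliation
  into terms covered by \<open>rank_one_ampliation_psd\<close>.\<close>

lemma measure_prepare_completely_positive:
  assumes G: "\<And>l. l < L \<Longrightarrow> positive_op n (G l)" and \<tau>: "\<And>l. l < L \<Longrightarrow> positive_op m (\<tau> l)"
  shows "completely_positive n m (measure_prepare n m L G \<tau>)"
  unfolding completely_positive_def
proof (intro conjI measure_prepare_linear allI impI)
  fix k X assume X: "positive_op (k * n) X"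
  let ?M = "ampliation k n m (measure_prepare n m L G \<tau>) X"
  have "\<exists>r W. \<forall>i<n. \<forall>j<n. G l $$ (i, j) = (\<Sum>g<r::nat. W g i * cnj (W g j))" if "l < L" for l
    using psd_decomposition[of n "entries (G l)"] G[OF that] by (simp add: positive_op_iff)
  then obtain rg W where W: "\<And>l i j. l < L \<Longrightarrow> i < n \<Longrightarrow> j < n \<Longrightarrow>
      G l $$ (i, j) = (\<Sum>g<rg l::nat. W l g i * cnj (W l g j))" by metis
  have "\<exists>r V. \<forall>i<m. \<forall>j<m. \<tau> l $$ (i, j) = (\<Sum>g<r::nat. V g i * cnj (V g j))" if "l < L" for l
    using psd_decomposition[of m "entries (\<tau> l)"] \<tau>[OF that] by (simp add: positive_op_iff)
  then obtain rt V where V: "\<And>l i j. l < L \<Longrightarrow> i < m \<Longrightarrow> j < m \<Longrightarrow>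
      \<tau> l $$ (i, j) = (\<Sum>t<rt l::nat. V l t i * cnj (V l t j))" by metis
  define E where "E l g t r s = (\<Sum>i<n. \<Sum>j<n. cnj (W l g i) * X $$ (r div m * n + i, s div m * n + j) * W l g j) *
      (V l t (r mod m) * cnj (V l t (s mod m)))" for l g t r s
  have "psd (k * m) (E l g t)" for l g t
    unfolding E_def[abs_def] using X by (intro rank_one_ampliation_psd) (simp add: positive_op_iff)
  then have "psd (k * m) (\<lambda>r s. \<Sum>l<L. \<Sum>g<rg l. \<Sum>t<rt l. E l g t r s)"
    by (intro psd_sum)
  moreover have "?M $$ (r, s) = (\<Sum>l<L. \<Sum>g<rg l. \<Sum>t<rt l. E l g t r s)" if rs: "r < k * m" "s < k * m" for r s
  proof -
    have m: "0 < m" using rs by (cases m) auto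
    let ?B = "mat n n (\<lambda>(i, j). X $$ (r div m * n + i, s div m * n + j))"
    have "?M $$ (r, s) = (\<Sum>l<L. pairing n (entries (G l)) (entries ?B) * \<tau> l $$ (r mod m, s mod m))"
      using rs m by (simp add: ampliation_def measure_prepare_def)
    also have "\<dots> = (\<Sum>l<L. \<Sum>g<rg l. \<Sum>t<rt l. E l g t r s)"
    proof (intro sum.cong refl)
      fix l assume l: "l \<in> {..<L}"
      have "pairing n (entries (G l)) (entries ?B) = (\<Sum>g<rg l. quad n (entries ?B) (W l g))"
        unfolding pairing_commute[of n "entries (G l)"]
        using W l by (intro pairing_rank_one_sum) auto
      also have "\<dots> = (\<Sum>g<rg l. \<Sum>i<n. \<Sum>j<n. cnj (W l g i) * X $$ (r div m * n + i, s div m * n + j) * W l g j)"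
        unfolding quad_def by (intro sum.cong refl) simp
      finally show "pairing n (entries (G l)) (entries ?B) * \<tau> l $$ (r mod m, s mod m) = (\<Sum>g<rg l. \<Sum>t<rt l. E l g t r s)"
        using V[of l "r mod m" "s mod m"] l m by (simp only: E_def sum_product lessThan_iff mod_less_divisor)
    qed
    finally show ?thesis .
  qed
  ultimately have "psd (k * m) (entries ?M)"
    using psd_cong[of "k * m" "entries ?M" "\<lambda>r s. \<Sum>l<L. \<Sum>g<rg l. \<Sum>t<rt l. E l g t r s"] by blast
  then show "positive_op (k * m) ?M"
    by (simp add: positive_op_iff ampliation_def)
qed

definition kron :: "nat \<Rightarrow> complex mat \<Rightarrow> complex mat \<Rightarrow> complex mat" where
  "kron d A B = mat (d * d) (d * d) (\<lambda>(r, s). A $$ (r div d, s div d) * B $$ (r mod d, s mod d))"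

lemma kron_entry:
  "i < d \<Longrightarrow> j < d \<Longrightarrow> i' < d \<Longrightarrow> j' < d \<Longrightarrow> kron d A B $$ (i * d + j, i' * d + j') = A $$ (i, i') * B $$ (j, j')"
  by (simp add: kron_def product_index_less)

lemma kron_positive:
  assumes A: "positive_op d A" and B: "positive_op d B"
  shows "positive_op (d * d) (kron d A B)"
proof -
  obtain ra W where W: "\<forall>i<d. \<forall>j<d. A $$ (i, j) = (\<Sum>k<ra::nat. W k i * cnj (W k j))"
    using psd_decomposition[of d "entries A"] A by (auto simp: positive_op_iff)
  obtain rb V where V: "\<forall>i<d. \<forall>j<d. B $$ (i, j) = (\<Sum>k<rb::nat. V k i * cnj (V k j))"
    using psd_decomposition[of d "entries B"] B by (auto simp: positive_op_iff)
  let ?z = "\<lambda>k l r. W k (r div d) * V l (r mod d)"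
  have "kron d A B $$ (r, s) = (\<Sum>k<ra. \<Sum>l<rb. ?z k l r * cnj (?z k l s))" if "r < d * d" "s < d * d" for r s
  proof -
    have "0 < d" using that by (cases d) auto
    then have lt: "r div d < d" "s div d < d" "r mod d < d" "s mod d < d"
      using that by (simp_all add: less_mult_imp_div_less)
    have "kron d A B $$ (r, s) = (\<Sum>k<ra. W k (r div d) * cnj (W k (s div d))) *
        (\<Sum>l<rb. V l (r mod d) * cnj (V l (s mod d)))"
      unfolding W[rule_format, OF lt(1,2), symmetric] V[rule_format, OF lt(3,4), symmetric]
      using that by (simp add: kron_def)
    also have "\<dots> = (\<Sum>k<ra. \<Sum>l<rb. ?z k l r * cnj (?z k l s))"
      unfolding sum_product by (intro sum.cong refl) (simp add: mult_ac)
    finally show ?thesis .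
  qed
  moreover have "psd (d * d) (\<lambda>r s. \<Sum>k<ra. \<Sum>l<rb. ?z k l r * cnj (?z k l s))"
    by (intro psd_sum psd_rank_one)
  ultimately have "psd (d * d) (entries (kron d A B))"
    using psd_cong[of "d * d" "entries (kron d A B)" "\<lambda>r s. \<Sum>k<ra. \<Sum>l<rb. ?z k l r * cnj (?z k l s)"] by blast
  then show ?thesis by (simp add: positive_op_iff kron_def)
qed

section \<open>Linear maps through matrix units, and their duals\<close>

lemma matrix_unit_carrier: "matrix_unit d a b \<in> carrier_mat d d"
  by (simp add: matrix_unit_def)

text \<open>Linearity holds only on the carrier, so the expansion in matrix units is built by adding
  one entry of \<open>X\<close> at a time.\<close>

lemma linear_map_entries:
  assumes J: "linear_map n m J" and X: "X \<in> carrier_mat n n" and pq: "p < m" "q < m"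
  shows "J X $$ (p, q) = (\<Sum>a<n. \<Sum>b<n. X $$ (a, b) * J (matrix_unit n a b) $$ (p, q))"
proof -
  define R where "R P = mat n n (\<lambda>z. if z \<in> P then X $$ z else 0)" for P
  have RC: "R P \<in> carrier_mat n n" for P by (simp add: R_def)
  have carr: "J Y \<in> carrier_mat m m" if "Y \<in> carrier_mat n n" for Y
    using J that by (simp add: linear_map_def)
  have add: "J (Y + Z) = J Y + J Z" if "Y \<in> carrier_mat n n" "Z \<in> carrier_mat n n" for Y Z
    using J that by (simp add: linear_map_def)
  have scale: "J (c \<cdot>\<^sub>m Y) = c \<cdot>\<^sub>m J Y" if "Y \<in> carrier_mat n n" for c Y
    using J that by (simp add: linear_map_def)
  have main: "J (R P) $$ (p, q) = (\<Sum>(a, b)\<in>P. X $$ (a, b) * J (matrix_unit n a b) $$ (p, q))"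
    if "finite P" "P \<subseteq> {..<n} \<times> {..<n}" for P
    using that
  proof (induction P)
    case empty
    have "R {} = 0 \<cdot>\<^sub>m R {}" by (intro eq_matI) (auto simp: R_def)
    then have "J (R {}) = J (0 \<cdot>\<^sub>m R {})" by (rule arg_cong)
    also have "\<dots> = 0 \<cdot>\<^sub>m J (R {})" by (rule scale[OF RC])
    finally have "J (R {}) $$ (p, q) = (0 \<cdot>\<^sub>m J (R {})) $$ (p, q)" by (rule arg_cong)
    also have "\<dots> = 0" using carr[OF RC, of "{}"] pq by simp
    finally show ?case by simp
  next
    case (insert z P)
    obtain a b where z: "z = (a, b)" by (cases z)
    have "R (insert z P) = R P + X $$ (a, b) \<cdot>\<^sub>m matrix_unit n a b"
      using insert.hyps by (intro eq_matI) (auto simp: R_def matrix_unit_def z)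
    then have "J (R (insert z P)) = J (R P) + X $$ (a, b) \<cdot>\<^sub>m J (matrix_unit n a b)"
      by (simp add: add scale RC matrix_unit_carrier)
    then have "J (R (insert z P)) $$ (p, q) = J (R P) $$ (p, q) + X $$ (a, b) * J (matrix_unit n a b) $$ (p, q)"
      using carr[OF RC, of P] carr[OF matrix_unit_carrier, of a b] pq by simp
    then show ?case using insert by (simp add: z add.commute)
  qed
  have "R ({..<n} \<times> {..<n}) = X" using X by (intro eq_matI) (auto simp: R_def)
  then show ?thesis
    using main[of "{..<n} \<times> {..<n}"] by (simp add: sum.cartesian_product)
qed

text \<open>The array on the left is the Heisenberg dual of \<open>Z\<close>, with the indices
  swapped as in \<open>heisenberg\<close>; this is the duality relation on rank-one inputs. The
  unequal dimensions admit the broadcasting map.\<close>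

lemma quad_dual:
  assumes J: "linear_map n m J"
  shows "quad n (\<lambda>i j. pairing m Z (entries (J (matrix_unit n j i)))) v =
    pairing m Z (entries (J (proj n v)))"
proof -
  let ?E = "\<lambda>a b. entries (J (matrix_unit n a b))"
  have "pairing m Z (entries (J (proj n v))) = pairing m (\<lambda>p q. \<Sum>a<n. \<Sum>b<n. (v a * cnj (v b)) * ?E a b p q) Z"
    unfolding pairing_commute[of m Z]
    by (intro pairing_cong refl, subst linear_map_entries[OF J proj_carrier])
      (auto simp: proj_def intro!: sum.cong)
  also have "\<dots> = (\<Sum>a<n. \<Sum>b<n. v a * cnj (v b) * pairing m (?E a b) Z)"
    unfolding pairing_sum_left pairing_scale_left ..
  also have "\<dots> = (\<Sum>b<n. \<Sum>a<n. v a * cnj (v b) * pairing m (?E a b) Z)"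
    by (rule sum.swap)
  also have "\<dots> = quad n (\<lambda>i j. pairing m Z (?E j i)) v"
    unfolding quad_def pairing_commute[of m Z] by (simp add: mult_ac)
  finally show ?thesis by simp
qed

lemma completely_positive_positive:
  assumes "completely_positive n m \<Lambda>" "positive_op n X"
  shows "positive_op m (\<Lambda> X)"
proof -
  have X: "X \<in> carrier_mat n n" using assms(2) by (rule positive_carrier)
  then have carr: "\<Lambda> X \<in> carrier_mat m m"
    using assms(1) by (simp add: completely_positive_def linear_map_def)
  have "positive_op (1 * m) (ampliation 1 n m \<Lambda> X)"
    using assms unfolding completely_positive_def by (metis mult_1)
  moreover have "mat n n (\<lambda>(i, j). X $$ (i, j)) = X" using X by (intro eq_matI) auto
  then have "ampliation 1 n m \<Lambda> X = \<Lambda> X"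
    using carr by (intro eq_matI) (auto simp: ampliation_def)
  ultimately show ?thesis by simp
qed

lemma one_smult_mat [simp]: "(1::complex) \<cdot>\<^sub>m A = A"
  by (intro eq_matI) auto

lemma mtrace_smult: "mtrace (c \<cdot>\<^sub>m A) = c * mtrace A" if "A \<in> carrier_mat n n"
  using that by (simp add: mtrace_def sum_distrib_left)

lemma measure_prepare_single:
  assumes "\<sigma> \<in> carrier_mat m m"
  shows "measure_prepare n m 1 (\<lambda>_. g) (\<lambda>_. \<sigma>) X = pairing n (entries g) (entries X) \<cdot>\<^sub>m \<sigma>"
  using assms by (intro eq_matI) (auto simp: measure_prepare_def)

lemma pairing_matrix_unit:
  assumes "i < n" "j < n"
  shows "pairing n A (entries (matrix_unit n j i)) = A i j"
proof -
  have "pairing n A (entries (matrix_unit n j i)) = (\<Sum>a<n. \<Sum>b<n. if a = i \<and> b = j then A i j else 0)"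
    unfolding pairing_def by (intro sum.cong refl) (auto simp: matrix_unit_def)
  also have "\<dots> = (\<Sum>a<n. if a = i then A i j else 0)"
    using assms by (intro sum.cong refl) auto
  finally show ?thesis using assms by simp
qed

lemma heisenberg_measure_prepare:
  assumes g: "g \<in> carrier_mat d d" and \<sigma>: "\<sigma> \<in> carrier_mat d d" and X: "X \<in> carrier_mat d d"
  shows "heisenberg d (measure_prepare d d 1 (\<lambda>_. g) (\<lambda>_. \<sigma>)) X = mtrace (X * \<sigma>) \<cdot>\<^sub>m g"
proof (rule eq_matI)
  fix i j assume "i < dim_row (mtrace (X * \<sigma>) \<cdot>\<^sub>m g)" "j < dim_col (mtrace (X * \<sigma>) \<cdot>\<^sub>m g)"
  then have ij: "i < d" "j < d" using g by auto
  have "mtrace (X * (g $$ (i, j) \<cdot>\<^sub>m \<sigma>)) = g $$ (i, j) * mtrace (X * \<sigma>)"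
    using X \<sigma> by (simp add: mult_smult_distrib[OF X \<sigma>] mtrace_smult[of _ d])
  then show "heisenberg d (measure_prepare d d 1 (\<lambda>_. g) (\<lambda>_. \<sigma>)) X $$ (i, j) = (mtrace (X * \<sigma>) \<cdot>\<^sub>m g) $$ (i, j)"
    using ij g by (simp add: heisenberg_def measure_prepare_single[OF \<sigma>] pairing_matrix_unit del: One_nat_def)
qed (use g in \<open>auto simp: heisenberg_def\<close>)

lemma state_trace: "\<sigma> \<in> states d \<Longrightarrow> (\<Sum>i<d. \<sigma> $$ (i, i)) = 1"
  using mtrace_entries[of \<sigma> d] by (simp add: states_def positive_carrier)

lemma state_positive: "\<sigma> \<in> states d \<Longrightarrow> positive_op d \<sigma>"
  by (simp add: states_def)

section \<open>Noncontextuality, broadcasting and repeatability by measure-and-prepare maps\<close>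

text \<open>On outcome \<open>l\<close> two copies of \<open>\<sigma>_l\<close> are prepared. Both
  marginals equal the sum of \<open>tr(G_l \<rho>) \<sigma>_l\<close>, and noncontextuality says
  exactly that the effects of \<open>\<A>\<close> do not tell it from \<open>\<rho>\<close>.\<close>

lemma broadcastable_if_noncontextual:
  assumes d: "0 < d" and \<A>: "\<forall>A\<in>\<A>. povm d A" and nc: "no_contextuality_proof d \<A>"
  shows "broadcastable d (states d) \<A> \<A>"
proof -
  obtain G \<sigma> where G: "povm d G" and \<sigma>: "length \<sigma> = length G" "\<forall>l<length \<sigma>. \<sigma> ! l \<in> states d"
    and eq: "\<forall>\<rho>\<in>states d. \<forall>A\<in>\<A>. \<forall>k<length A.
           mtrace (\<rho> * A ! k) = (\<Sum>l<length G. mtrace (\<rho> * G ! l) * mtrace (\<sigma> ! l * A ! k))"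
    using nc unfolding no_contextuality_proof_def by blast
  let ?L = "length G"
  let ?g = "\<lambda>l X. pairing d (entries (G ! l)) (entries X)"
  define \<Lambda> where "\<Lambda> = measure_prepare d (d * d) ?L (\<lambda>l. G ! l) (\<lambda>l. kron d (\<sigma> ! l) (\<sigma> ! l))"
  have \<sigma>st: "\<sigma> ! l \<in> states d" if "l < ?L" for l using \<sigma> that by simp
  have \<Lambda>_entry: "\<Lambda> X $$ (i * d + j, i' * d + j') = (\<Sum>l<?L. ?g l X * (\<sigma> ! l $$ (i, i') * \<sigma> ! l $$ (j, j')))"
    if "i < d" "j < d" "i' < d" "j' < d" for X i j i' j'
    using that by (simp add: \<Lambda>_def measure_prepare_def product_index_less kron_entry)
  have cp: "completely_positive d (d * d) \<Lambda>"
    unfolding \<Lambda>_def using povm_length(1)[OF G] \<sigma>st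
    by (intro measure_prepare_completely_positive kron_positive) (auto simp: state_positive)
  have tp: "trace_preserving d \<Lambda>"
    unfolding trace_preserving_def
  proof
    fix X :: "complex mat" assume X: "X \<in> carrier_mat d d"
    have "mtrace (\<Lambda> X) = (\<Sum>r<d * d. \<Lambda> X $$ (r, r))"
      by (intro mtrace_entries) (simp add: \<Lambda>_def measure_prepare_def)
    also have "\<dots> = (\<Sum>i<d. \<Sum>j<d. \<Sum>l<?L. ?g l X * (\<sigma> ! l $$ (i, i) * \<sigma> ! l $$ (j, j)))"
      unfolding sum_product_index by (intro sum.cong refl) (simp add: \<Lambda>_entry)
    also have "\<dots> = (\<Sum>i<d. \<Sum>l<?L. \<Sum>j<d. ?g l X * (\<sigma> ! l $$ (i, i) * \<sigma> ! l $$ (j, j)))"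
      by (rule sum.cong[OF refl], rule sum.swap)
    also have "\<dots> = (\<Sum>l<?L. \<Sum>i<d. \<Sum>j<d. ?g l X * (\<sigma> ! l $$ (i, i) * \<sigma> ! l $$ (j, j)))"
      by (rule sum.swap)
    also have "\<dots> = (\<Sum>l<?L. ?g l X)"
      by (intro sum.cong refl) (simp add: state_trace \<sigma>st flip: sum_distrib_left)
    also have "\<dots> = mtrace X"
      unfolding povm_pairing_sum[OF G] mtrace_entries[OF X] ..
    finally show "mtrace (\<Lambda> X) = mtrace X" .
  qed
  have pt2: "ptrace2 d (\<Lambda> \<rho>) = mat d d (\<lambda>(i, i'). \<Sum>l<?L. ?g l \<rho> * \<sigma> ! l $$ (i, i'))" for \<rho>
  proof (rule eq_matI)
    fix i i' assume "i < dim_row (mat d d (\<lambda>(i, i'). \<Sum>l<?L. ?g l \<rho> * \<sigma> ! l $$ (i, i')))"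
      "i' < dim_col (mat d d (\<lambda>(i, i'). \<Sum>l<?L. ?g l \<rho> * \<sigma> ! l $$ (i, i')))"
    then have i: "i < d" "i' < d" by auto
    have "ptrace2 d (\<Lambda> \<rho>) $$ (i, i') = (\<Sum>j<d. \<Sum>l<?L. ?g l \<rho> * (\<sigma> ! l $$ (i, i') * \<sigma> ! l $$ (j, j)))"
      using i by (simp add: ptrace2_def \<Lambda>_entry)
    also have "\<dots> = (\<Sum>l<?L. \<Sum>j<d. ?g l \<rho> * (\<sigma> ! l $$ (i, i') * \<sigma> ! l $$ (j, j)))"
      by (rule sum.swap)
    also have "\<dots> = (\<Sum>l<?L. ?g l \<rho> * \<sigma> ! l $$ (i, i'))"
      by (intro sum.cong refl) (simp add: state_trace \<sigma>st flip: sum_distrib_left)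
    finally show "ptrace2 d (\<Lambda> \<rho>) $$ (i, i') = mat d d (\<lambda>(i, i'). \<Sum>l<?L. ?g l \<rho> * \<sigma> ! l $$ (i, i')) $$ (i, i')"
      using i by simp
  qed (auto simp: ptrace2_def)
  have pt1: "ptrace1 d (\<Lambda> \<rho>) = ptrace2 d (\<Lambda> \<rho>)" for \<rho>
    by (intro eq_matI) (auto simp: ptrace1_def ptrace2_def \<Lambda>_entry mult.commute)
  have main: "mtrace (A ! k * ptrace2 d (\<Lambda> \<rho>)) = mtrace (A ! k * \<rho>)"
    if A: "A \<in> \<A>" "k < length A" and \<rho>: "\<rho> \<in> states d" for A k \<rho>
  proof -
    have Ak: "A ! k \<in> carrier_mat d d"
      using \<A> A povm_length(1) positive_carrier by blast
    have \<rho>c: "\<rho> \<in> carrier_mat d d" using \<rho> by (simp add: states_def positive_carrier)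
    have "mtrace (A ! k * ptrace2 d (\<Lambda> \<rho>)) = pairing d (entries (ptrace2 d (\<Lambda> \<rho>))) (entries (A ! k))"
      by (subst mtrace_mult[OF Ak]) (simp_all add: pairing_commute ptrace2_def)
    also have "\<dots> = pairing d (\<lambda>i i'. \<Sum>l<?L. ?g l \<rho> * \<sigma> ! l $$ (i, i')) (entries (A ! k))"
      unfolding pt2 by (intro pairing_cong) auto
    also have "\<dots> = (\<Sum>l<?L. ?g l \<rho> * pairing d (entries (\<sigma> ! l)) (entries (A ! k)))"
      unfolding pairing_sum_left pairing_scale_left ..
    also have "\<dots> = (\<Sum>l<?L. mtrace (\<rho> * G ! l) * mtrace (\<sigma> ! l * A ! k))"
    proof (intro sum.cong refl)
      fix l assume "l \<in> {..<?L}"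
      then have "G ! l \<in> carrier_mat d d" "\<sigma> ! l \<in> carrier_mat d d"
        using povm_length(1)[OF G] \<sigma>st positive_carrier state_positive by auto
      then show "?g l \<rho> * pairing d (entries (\<sigma> ! l)) (entries (A ! k)) = mtrace (\<rho> * G ! l) * mtrace (\<sigma> ! l * A ! k)"
        using \<rho>c Ak by (simp add: mtrace_mult[of _ d] pairing_commute)
    qed
    also have "\<dots> = mtrace (\<rho> * A ! k)" using eq A \<rho> by simp
    also have "\<dots> = mtrace (A ! k * \<rho>)" using \<rho>c Ak by (rule mtrace_commute)
    finally show ?thesis .
  qed
  show ?thesis
    unfolding broadcastable_def cptp_def
    using cp tp main pt1 by (intro exI[of _ \<Lambda>]) simp
qed

text \<open>Branch \<open>l\<close> prepares a vector \<open>\<psi>_l\<close> with expectation 1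
  under \<open>G_l\<close>. Its dual sends \<open>X\<close> to the expectation of \<open>X\<close>
  in \<open>\<psi>_l\<close> times \<open>G_l\<close>, so \<open>1\<close> and \<open>G_l\<close>
  have the same image \<open>G_l\<close>.\<close>

lemma repeatable_if_op_norm_1:
  assumes d: "0 < d" and G: "povm d G" and norm: "\<forall>l<length G. op_norm d (G ! l) = 1"
  shows "repeatable d G"
proof -
  let ?L = "length G"
  have pos: "positive_op d (G ! l)" if "l < ?L" for l using povm_length(1)[OF G that] .
  have "\<exists>\<psi>. norm2 d \<psi> = 1 \<and> quad d (entries (G ! l)) \<psi> = 1" if "l < ?L" for l
    using op_norm_attained[OF d pos[OF that]] norm that by auto
  then obtain \<psi> where \<psi>: "\<And>l. l < ?L \<Longrightarrow> norm2 d (\<psi> l) = 1"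
    "\<And>l. l < ?L \<Longrightarrow> quad d (entries (G ! l)) (\<psi> l) = 1" by metis
  define J where "J l = measure_prepare d d 1 (\<lambda>_. G ! l) (\<lambda>_. proj d (\<psi> l))" for l
  define \<I> where "\<I> = map J [0..<?L]"
  have len: "length \<I> = ?L" and nth: "\<And>l. l < ?L \<Longrightarrow> \<I> ! l = J l" by (simp_all add: \<I>_def)
  have J_eq: "J l X = pairing d (entries (G ! l)) (entries X) \<cdot>\<^sub>m proj d (\<psi> l)" for l X
    unfolding J_def by (rule measure_prepare_single[OF proj_carrier])
  have trJ: "mtrace (J l X) = pairing d (entries (G ! l)) (entries X)" if "l < ?L" for l X
    using \<psi>(1)[OF that] by (simp add: J_eq mtrace_smult[OF proj_carrier] mtrace_proj)
  have cp: "completely_positive d d (J l)" if "l < ?L" for l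
    unfolding J_def using pos[OF that] proj_positive by (intro measure_prepare_completely_positive) auto
  have le: "Re (mtrace (J l \<rho>)) \<le> Re (mtrace \<rho>)" if l: "l < ?L" and \<rho>: "positive_op d \<rho>" for l \<rho>
  proof -
    have "0 \<le> pairing d (entries (G ! k)) (entries \<rho>)" if "k < ?L" for k
      using pos[OF that] \<rho> by (intro pairing_nonneg) (auto simp: positive_op_iff)
    then have "Re (mtrace (J l \<rho>)) \<le> (\<Sum>k<?L. Re (pairing d (entries (G ! k)) (entries \<rho>)))"
      unfolding trJ[OF l] using l by (intro member_le_sum) (auto simp: less_eq_complex_def)
    also have "\<dots> = Re (mtrace \<rho>)"
      unfolding Re_sum[symmetric] povm_pairing_sum[OF G] mtrace_entries[OF positive_carrier[OF \<rho>]] ..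
    finally show ?thesis .
  qed
  have tp: "trace_preserving d (\<lambda>X. msum d (\<lambda>k. (\<I> ! k) X) {..<length \<I>})"
    unfolding trace_preserving_def
  proof
    fix X :: "complex mat" assume X: "X \<in> carrier_mat d d"
    have "mtrace (msum d (\<lambda>k. (\<I> ! k) X) {..<length \<I>}) = (\<Sum>i<d. \<Sum>k<?L. J k X $$ (i, i))"
      by (simp add: mtrace_def msum_def len nth)
    also have "\<dots> = (\<Sum>k<?L. \<Sum>i<d. J k X $$ (i, i))" by (rule sum.swap)
    also have "\<dots> = (\<Sum>k<?L. mtrace (J k X))"
      by (intro sum.cong refl mtrace_entries[symmetric]) (simp add: J_eq proj_def)
    also have "\<dots> = (\<Sum>k<?L. pairing d (entries (G ! k)) (entries X))"
      by (intro sum.cong refl) (simp add: trJ)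
    also have "\<dots> = mtrace X"
      unfolding mtrace_entries[OF X] povm_pairing_sum[OF G] ..
    finally show "mtrace (msum d (\<lambda>k. (\<I> ! k) X) {..<length \<I>}) = mtrace X" .
  qed
  have heis: "heisenberg d (J l) X = mtrace (X * proj d (\<psi> l)) \<cdot>\<^sub>m (G ! l)"
    if "l < ?L" "X \<in> carrier_mat d d" for l X
    unfolding J_def using pos[OF that(1)] that(2)
    by (intro heisenberg_measure_prepare proj_carrier) (auto dest: positive_carrier)
  have h1: "heisenberg d (J l) (1\<^sub>m d) = G ! l" if "l < ?L" for l
    using \<psi>(1)[OF that] left_mult_one_mat[OF proj_carrier]
    by (simp add: heis that mtrace_proj)
  have hG: "heisenberg d (J l) (G ! l) = G ! l" if "l < ?L" for l
    using \<psi>(2)[OF that] positive_carrier[OF pos[OF that]]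
    by (simp add: heis that mtrace_mult_proj)
  show ?thesis
    unfolding repeatable_def implements_def instrument_def
    using cp le tp h1 hG by (intro exI[of _ \<I>]) (simp add: len nth)
qed

text \<open>The dual branch is positive; applied to \<open>c 1 - G_l \<ge> 0\<close> with
  \<open>c\<close> the norm, it yields \<open>c G_l - G_l \<ge> 0\<close>. A unit vector is supplied
  even for a zero effect, so that every outcome can be assigned a state.\<close>

lemma repeatable_effect:
  assumes d: "0 < d" and G: "povm d G" and rep: "repeatable d G" and l: "l < length G"
  shows "\<exists>\<psi>. norm2 d \<psi> = 1 \<and> (G ! l = 0\<^sub>m d d \<or> quad d (entries (G ! l)) \<psi> = 1)"
proof -
  obtain \<I> where \<I>: "implements d \<I> G" and fixed: "heisenberg d (\<I> ! l) (G ! l) = G ! l"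
    using rep l unfolding repeatable_def by blast
  let ?J = "\<I> ! l" and ?g = "entries (G ! l)"
  have cp: "completely_positive d d ?J" and one: "heisenberg d ?J (1\<^sub>m d) = G ! l"
    using \<I> l by (auto simp: implements_def instrument_def)
  have lin: "linear_map d d ?J" using cp by (simp add: completely_positive_def)
  have pos: "positive_op d (G ! l)" using povm_length(1)[OF G l] .
  have carr: "G ! l \<in> carrier_mat d d" using pos by (rule positive_carrier)
  define c where "c = op_norm d (G ! l)"
  obtain \<psi> where \<psi>: "norm2 d \<psi> = 1" "quad d ?g \<psi> = of_real c"
    and le: "\<And>v. Re (quad d ?g v) \<le> c * norm2 d v"
    using op_norm_attained[OF d pos] unfolding c_def by blast
  have dual: "quad d (entries (heisenberg d ?J X)) v = pairing d (entries X) (entries (?J (proj d v)))"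
    if X: "X \<in> carrier_mat d d" for X v
    unfolding quad_dual[OF lin, symmetric]
  proof (rule quad_cong)
    fix i j assume "i < d" "j < d"
    moreover have "?J (matrix_unit d j i) \<in> carrier_mat d d"
      using lin matrix_unit_carrier by (simp add: linear_map_def)
    ultimately show "entries (heisenberg d ?J X) i j = pairing d (entries X) (entries (?J (matrix_unit d j i)))"
      using X by (simp add: heisenberg_def mtrace_mult[of _ d])
  qed simp
  let ?id = "\<lambda>i j. if i = j then 1 else (0::complex)"
  have "psd d (\<lambda>i j. complex_of_real c * ?id i j - ?g i j)"
  proof -
    have "psd d ?g" using pos by (simp add: positive_op_iff)
    then have "quad d (\<lambda>i j. complex_of_real c * ?id i j - ?g i j) v = of_real (c * norm2 d v - Re (quad d ?g v))" for v
      unfolding quad_diff quad_scale quad_one by (subst psd_real) simp_all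
    then show ?thesis using le by (simp add: psd_def less_eq_complex_def)
  qed
  moreover have "psd d (entries (?J (proj d v)))" for v
    using completely_positive_positive[OF cp proj_positive] by (simp add: positive_op_iff)
  ultimately have nn: "0 \<le> pairing d (\<lambda>i j. complex_of_real c * ?id i j - ?g i j) (entries (?J (proj d v)))" for v
    by (rule pairing_nonneg)
  have one_id: "pairing d (entries (1\<^sub>m d)) X = pairing d ?id X" for X
    by (intro pairing_cong) auto
  have "pairing d (\<lambda>i j. complex_of_real c * ?id i j - ?g i j) X = c * pairing d ?id X - pairing d ?g X" for X
    by (simp add: pairing_def sum_distrib_left sum_subtractf left_diff_distrib mult.assoc)
  then have "pairing d (\<lambda>i j. complex_of_real c * ?id i j - ?g i j) (entries (?J (proj d v))) =
      c * quad d (entries (heisenberg d ?J (1\<^sub>m d))) v - quad d (entries (heisenberg d ?J (G ! l))) v" for v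
    unfolding dual[OF one_carrier_mat] dual[OF carr] one_id .
  then have "0 \<le> c * quad d ?g v - quad d ?g v" for v
    using nn[of v] unfolding one fixed by metis
  \<comment> \<open>A vector with positive expectation forces \<open>c \<ge> 1\<close>; the bound
    \<open>c \<le> 1\<close> comes from the other effects being nonnegative.\<close>
  then have key: "0 \<le> (c - 1) * Re (quad d ?g v)" for v
    by (simp add: less_eq_complex_def algebra_simps)
  show ?thesis
  proof (cases "\<exists>v. quad d ?g v \<noteq> 0")
    case True
    then obtain v where v: "quad d ?g v \<noteq> 0" by blast
    have "0 \<le> quad d ?g v" using pos by (simp add: positive_op_iff psd_def)
    with v have "0 < Re (quad d ?g v)" by (auto simp: less_eq_complex_def complex_eq_iff)
    then have "1 \<le> c" using key[of v] by (simp add: zero_le_mult_iff)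
    moreover have "c \<le> 1"
    proof -
      have "0 \<le> quad d (entries (G ! k)) \<psi>" if "k < length G" for k
        using povm_length(1)[OF G that] by (simp add: positive_op_iff psd_def)
      then have "Re (quad d ?g \<psi>) \<le> (\<Sum>k<length G. Re (quad d (entries (G ! k)) \<psi>))"
        using l by (intro member_le_sum) (auto simp: less_eq_complex_def)
      then show ?thesis
        unfolding Re_sum[symmetric] povm_quad_sum[OF G] using \<psi> by simp
    qed
    ultimately show ?thesis using \<psi> by auto
  next
    case False
    then have "G ! l = 0\<^sub>m d d"
      using quad_zero_imp_zero[of d ?g] carr by (intro eq_matI) auto
    then show ?thesis using \<psi>(1) by blast
  qed
qed

lemma povm_sharp_quad:
  assumes G: "povm d G" and \<psi>: "norm2 d \<psi> = 1" "quad d (entries (G ! l)) \<psi> = 1"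
    and l: "l < length G" and m: "m < length G" "m \<noteq> l"
  shows "quad d (entries (G ! m)) \<psi> = 0"
proof -
  have nn: "0 \<le> quad d (entries (G ! k)) \<psi>" if "k < length G" for k
    using povm_length(1)[OF G that] by (simp add: positive_op_iff psd_def)
  have "(\<Sum>k<length G. quad d (entries (G ! k)) \<psi>) = 1"
    unfolding povm_quad_sum[OF G] using \<psi> by simp
  moreover have "(\<Sum>k<length G. quad d (entries (G ! k)) \<psi>) =
      quad d (entries (G ! l)) \<psi> + (\<Sum>k\<in>{..<length G} - {l}. quad d (entries (G ! k)) \<psi>)"
    using l by (intro sum.remove) auto
  ultimately have "(\<Sum>k\<in>{..<length G} - {l}. quad d (entries (G ! k)) \<psi>) = 0"
    using \<psi>(2) by simp
  then show ?thesis
    using nn m by (subst (asm) sum_nonneg_eq_0_iff) auto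
qed

text \<open>In the vector state that identifies outcome \<open>l\<close>, the expectation of
  \<open>A_k\<close> is the post-processing weight \<open>p(k|l)\<close>, so the post-processing
  formula is already the required model.\<close>

lemma noncontextual_if_repeatable:
  assumes d: "0 < d" and G: "povm d G" and rep: "repeatable d G"
    and pp: "\<forall>A\<in>\<A>. post_processing d A G"
  shows "no_contextuality_proof d \<A>"
proof -
  let ?L = "length G"
  obtain \<psi> where \<psi>: "\<And>l. l < ?L \<Longrightarrow> norm2 d (\<psi> l) = 1"
    "\<And>l. l < ?L \<Longrightarrow> G ! l = 0\<^sub>m d d \<or> quad d (entries (G ! l)) (\<psi> l) = 1"
    using repeatable_effect[OF d G rep] by metis
  define \<sigma> where "\<sigma> = map (\<lambda>l. proj d (\<psi> l)) [0..<?L]"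
  have Gc: "G ! l \<in> carrier_mat d d" if "l < ?L" for l
    using povm_length(1)[OF G that] by (rule positive_carrier)
  have "mtrace (\<rho> * A ! k) = (\<Sum>l<?L. mtrace (\<rho> * G ! l) * mtrace (\<sigma> ! l * A ! k))"
    if \<rho>: "\<rho> \<in> states d" and A: "A \<in> \<A>" "k < length A" for \<rho> A k
  proof -
    have \<rho>c: "\<rho> \<in> carrier_mat d d" using \<rho> by (simp add: states_def positive_carrier)
    obtain p where p: "A ! k = msum d (\<lambda>l. complex_of_real (p k l) \<cdot>\<^sub>m G ! l) {..<?L}"
      using pp A unfolding post_processing_def by blast
    have Ak: "A ! k = mat d d (\<lambda>(i, j). \<Sum>l<?L. complex_of_real (p k l) * G ! l $$ (i, j))"
      unfolding p msum_def
    proof (rule cong_mat)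
      fix i j assume "i < d" "j < d"
      then have "(complex_of_real (p k l) \<cdot>\<^sub>m G ! l) $$ (i, j) = complex_of_real (p k l) * G ! l $$ (i, j)"
        if "l < ?L" for l using Gc[OF that] by simp
      then show "(case (i, j) of (i, j) \<Rightarrow> \<Sum>l<?L. (complex_of_real (p k l) \<cdot>\<^sub>m G ! l) $$ (i, j)) =
          (case (i, j) of (i, j) \<Rightarrow> \<Sum>l<?L. complex_of_real (p k l) * G ! l $$ (i, j))"
        by simp
    qed simp_all
    then have Akc: "A ! k \<in> carrier_mat d d" by simp
    have term_eq: "p k l * pairing d (entries (G ! l)) (entries \<rho>) = mtrace (\<rho> * G ! l) * mtrace (\<sigma> ! l * A ! k)"
      if l: "l < ?L" for l
    \<comment> \<open>A zero effect has no identifying vector, but its term vanishes on both sides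
      whatever the state.\<close>
    proof (cases "G ! l = 0\<^sub>m d d")
      case True
      then have "pairing d (entries (G ! l)) (entries \<rho>) = 0" by (simp add: pairing_def)
      then show ?thesis using \<rho>c Gc[OF l] by (simp add: mtrace_mult[of _ d] pairing_commute)
    next
      case False
      then have sharp: "quad d (entries (G ! l)) (\<psi> l) = 1" using \<psi>(2)[OF l] by blast
      have "mtrace (\<sigma> ! l * A ! k) = quad d (entries (A ! k)) (\<psi> l)"
        using l mtrace_commute[OF proj_carrier Akc] mtrace_mult_proj[OF Akc] by (simp add: \<sigma>_def)
      also have "\<dots> = quad d (\<lambda>i j. \<Sum>m<?L. complex_of_real (p k m) * G ! m $$ (i, j)) (\<psi> l)"
        unfolding Ak by (intro quad_cong) auto
      also have "\<dots> = (\<Sum>m<?L. p k m * quad d (entries (G ! m)) (\<psi> l))"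
        unfolding quad_sum quad_scale ..
      also have "\<dots> = (\<Sum>m<?L. if m = l then complex_of_real (p k l) else 0)"
        using povm_sharp_quad[OF G \<psi>(1)[OF l] sharp l] sharp by (intro sum.cong refl) auto
      also have "\<dots> = p k l" using l by simp
      finally show ?thesis
        using \<rho>c Gc[OF l] by (simp add: mtrace_mult[of _ d] pairing_commute)
    qed
    have "mtrace (\<rho> * A ! k) = pairing d (entries (A ! k)) (entries \<rho>)"
      using \<rho>c Akc by (simp add: mtrace_mult[of _ d] pairing_commute)
    also have "\<dots> = pairing d (\<lambda>i j. \<Sum>l<?L. complex_of_real (p k l) * G ! l $$ (i, j)) (entries \<rho>)"
      unfolding Ak by (intro pairing_cong) auto
    also have "\<dots> = (\<Sum>l<?L. p k l * pairing d (entries (G ! l)) (entries \<rho>))"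
      unfolding pairing_sum_left pairing_scale_left ..
    finally show ?thesis using term_eq by simp
  qed
  then show ?thesis
    unfolding no_contextuality_proof_def
    using G \<psi>(1) by (intro exI[of _ G] exI[of _ \<sigma>]) (auto simp: \<sigma>_def proj_state)
qed

section \<open>From broadcasting to a sharp observable\<close>

text \<open>Pointwise scaling, used twice nested, makes arrays a real vector space and so an
  instance of the type required by the locale.\<close>

instantiation "fun" :: (type, real_vector) real_vector
begin

definition scaleR_fun_def: "scaleR r f = (\<lambda>x. r *\<^sub>R f x)"

instance
  by standard (simp_all add: scaleR_fun_def fun_eq_iff scaleR_add_right scaleR_add_left)

end

lemma scaleR_fun_apply [simp]: "(r *\<^sub>R f) x = r *\<^sub>R f x"
  by (simp add: scaleR_fun_def)

lemma sum_fun_apply2: "(\<Sum>i\<in>I. f i) x = (\<Sum>i\<in>I. f i x :: 'a::ab_group_add)"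
  by (induction I rule: infinite_finite_induct) auto

lemma quad_plus: "quad n (X + Y) v = quad n X v + quad n Y v"
  using quad_add[of n X Y v] by (simp add: plus_fun_def)

lemma quad_minus: "quad n (X - Y) v = quad n X v - quad n Y v"
  using quad_diff[of n X Y v] by (simp add: fun_diff_def)

lemma quad_scaleR: "quad n (r *\<^sub>R X) v = of_real r * quad n X v"
  using quad_scale[of n "of_real r" X v] by (simp add: scaleR_fun_def scaleR_conv_of_real)

text \<open>Zero padding outside the \<open>d\<close> by \<open>d\<close> block makes equality of
  arrays coincide with equality of operators; hermiticity is expressed by real expectations.\<close>

definition herm_arrays :: "nat \<Rightarrow> (nat \<Rightarrow> nat \<Rightarrow> complex) set" where
  "herm_arrays d = {X. (\<forall>i j. \<not> (i < d \<and> j < d) \<longrightarrow> X i j = 0) \<and> (\<forall>v. Im (quad d X v) = 0)}"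

definition array_unit :: "nat \<times> nat \<Rightarrow> complex \<Rightarrow> nat \<Rightarrow> nat \<Rightarrow> complex" where
  "array_unit z c = (\<lambda>i j. if (i, j) = z then c else 0)"

text \<open>A real spanning set of all complex \<open>d\<close> by \<open>d\<close> arrays; its
  members are generally not hermitian.\<close>

definition array_basis :: "nat \<Rightarrow> (nat \<Rightarrow> nat \<Rightarrow> complex) set" where
  "array_basis d = (\<Union>z\<in>{..<d} \<times> {..<d}. {array_unit z 1, array_unit z \<i>})"

definition vector_states :: "nat \<Rightarrow> ((nat \<Rightarrow> nat \<Rightarrow> complex) \<Rightarrow> real) set" where
  "vector_states d = {\<lambda>X. Re (quad d X v) | v. norm2 d v = 1}"

definition id_array :: "nat \<Rightarrow> nat \<Rightarrow> nat \<Rightarrow> complex" where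
  "id_array d = (\<lambda>i j. if i = j \<and> i < d then 1 else 0)"

text \<open>Unlike \<open>kron\<close> it has no index bounds, so it is bilinear on all arrays, as
  the locale demands of the product built from it.\<close>

definition kron_array :: "nat \<Rightarrow> (nat \<Rightarrow> nat \<Rightarrow> complex) \<Rightarrow> (nat \<Rightarrow> nat \<Rightarrow> complex) \<Rightarrow> nat \<Rightarrow> nat \<Rightarrow> complex" where
  "kron_array d X Y = (\<lambda>r s. X (r div d) (s div d) * Y (r mod d) (s mod d))"

definition dual_product :: "nat \<Rightarrow> (complex mat \<Rightarrow> complex mat) \<Rightarrow> (nat \<Rightarrow> nat \<Rightarrow> complex) \<Rightarrow>
    (nat \<Rightarrow> nat \<Rightarrow> complex) \<Rightarrow> nat \<Rightarrow> nat \<Rightarrow> complex" where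
  "dual_product d \<Lambda> X Y = (\<lambda>i j. if i < d \<and> j < d
     then pairing (d * d) (kron_array d X Y) (entries (\<Lambda> (matrix_unit d j i))) else 0)"

text \<open>Symmetrising over the two output systems makes both marginals of the broadcasting map equal.\<close>

definition sym_product :: "nat \<Rightarrow> (complex mat \<Rightarrow> complex mat) \<Rightarrow> (nat \<Rightarrow> nat \<Rightarrow> complex) \<Rightarrow>
    (nat \<Rightarrow> nat \<Rightarrow> complex) \<Rightarrow> nat \<Rightarrow> nat \<Rightarrow> complex" where
  "sym_product d \<Lambda> X Y = (1/2) *\<^sub>R (dual_product d \<Lambda> X Y + dual_product d \<Lambda> Y X)"

lemma subspace_herm_arrays: "subspace (herm_arrays d)"
  unfolding subspace_def herm_arrays_def
  by (auto simp: quad_plus quad_scaleR) (simp add: quad_def)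

lemma herm_arrays_span: "herm_arrays d \<subseteq> span (array_basis d)"
proof
  fix X assume X: "X \<in> herm_arrays d"
  let ?I = "{..<d} \<times> {..<d}"
  let ?f = "\<lambda>z. Re (X (fst z) (snd z)) *\<^sub>R array_unit z 1 + Im (X (fst z) (snd z)) *\<^sub>R array_unit z \<i>"
  have "X i j = (\<Sum>z\<in>?I. ?f z) i j" for i j
  proof -
    have "?f z i j = (if (i, j) = z then X i j else 0)" for z
      by (auto simp: array_unit_def complex_eq_iff)
    then have "(\<Sum>z\<in>?I. ?f z) i j = (\<Sum>z\<in>?I. if (i, j) = z then X i j else 0)"
      unfolding sum_fun_apply2 by simp
    also have "\<dots> = (if (i, j) \<in> ?I then X i j else 0)"
      by (subst sum.delta') auto
    also have "\<dots> = X i j" using X by (auto simp: herm_arrays_def)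
    finally show ?thesis by simp
  qed
  then have "X = (\<Sum>z\<in>?I. ?f z)" by (intro ext)
  moreover have "?f z \<in> span (array_basis d)" if "z \<in> ?I" for z
    using that by (intro span_add span_scale span_base) (auto simp: array_basis_def)
  ultimately show "X \<in> span (array_basis d)" by (metis (no_types, lifting) span_sum)
qed

lemma quad_eq_if_unit:
  assumes d: "0 < d" and eq: "\<And>w. norm2 d w = 1 \<Longrightarrow> quad d A w = quad d B w"
  shows "quad d A v = quad d B v"
proof -
  obtain w where w: "norm2 d w = 1" "\<And>A. quad d A v = of_real (norm2 d v) * quad d A w"
    using unit_vector_reduction[OF d] by blast
  show ?thesis using w(2)[of A] w(2)[of B] eq[OF w(1)] by simp
qed

text \<open>Scaling passes from unit vectors to all vectors, and polarisation from forms to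
  entries.\<close>

lemma array_eq_if_unit:
  assumes d: "0 < d" and eq: "\<And>w. norm2 d w = 1 \<Longrightarrow> quad d A w = quad d B w"
    and supp: "\<And>i j. \<not> (i < d \<and> j < d) \<Longrightarrow> A i j = B i j"
  shows "A = B"
proof (intro ext)
  fix i j
  have "quad d (\<lambda>i j. A i j - B i j) v = 0" for v
    unfolding quad_diff using quad_eq_if_unit[OF d eq] by simp
  then show "A i j = B i j" using quad_zero_imp_zero[of d "\<lambda>i j. A i j - B i j" i j] supp by fastforce
qed

lemma quad_bounded:
  assumes "norm2 d v = 1"
  shows "cmod (quad d X v) \<le> (\<Sum>i<d. \<Sum>j<d. cmod (X i j))"
proof -
  have le: "cmod (v i) \<le> 1" if "i < d" for i
    using assms that by (rule unit_vector_component_le)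
  have "cmod (quad d X v) \<le> (\<Sum>i<d. \<Sum>j<d. cmod (cnj (v i) * X i j * v j))"
    unfolding quad_def by (intro sum_norm_le order_refl)
  also have "\<dots> \<le> (\<Sum>i<d. \<Sum>j<d. cmod (X i j))"
  proof (intro sum_mono)
    fix i j assume ij: "i \<in> {..<d}" "j \<in> {..<d}"
    have "cmod (cnj (v i) * X i j * v j) = cmod (X i j) * (cmod (v i) * cmod (v j))"
      by (simp add: norm_mult)
    also have "\<dots> \<le> cmod (X i j) * (1 * 1)"
      using le ij by (intro mult_left_mono mult_mono) auto
    finally show "cmod (cnj (v i) * X i j * v j) \<le> cmod (X i j)" by simp
  qed
  finally show ?thesis .
qed

lemma quad_id_array: "quad d (id_array d) v = norm2 d v"
  unfolding quad_one[symmetric] by (intro quad_cong) (auto simp: id_array_def)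

lemma psd_if_vector_states_nonneg:
  assumes d: "0 < d" and X: "X \<in> herm_arrays d" and nn: "\<And>\<phi>. \<phi> \<in> vector_states d \<Longrightarrow> 0 \<le> \<phi> X"
  shows "psd d X"
  unfolding psd_def
proof
  fix v
  obtain w where w: "norm2 d w = 1" "\<And>A. quad d A v = of_real (norm2 d v) * quad d A w"
    using unit_vector_reduction[OF d] by blast
  have "0 \<le> Re (quad d X w)" using nn[of "\<lambda>X. Re (quad d X w)"] w(1) by (auto simp: vector_states_def)
  moreover have "Im (quad d X w) = 0" using X by (simp add: herm_arrays_def)
  ultimately show "0 \<le> quad d X v"
    unfolding w(2)[of X] using norm2_nonneg[of d v] by (simp add: less_eq_complex_def)
qed

section \<open>The dual of the broadcasting channel as a positive product\<close>

lemma psd_kron_array: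
  assumes X: "psd d X" and Y: "psd d Y"
  shows "psd (d * d) (kron_array d X Y)"
proof -
  let ?m = "\<lambda>X. mat d d (\<lambda>(i, j). X i j)"
  have pos: "positive_op d (?m Z)" if "psd d Z" for Z
    using that psd_cong[of d "entries (?m Z)" Z] by (simp add: positive_op_iff)
  have "psd (d * d) (entries (kron d (?m X) (?m Y)))"
    using kron_positive[OF pos[OF X] pos[OF Y]] by (simp add: positive_op_iff)
  moreover have "entries (kron d (?m X) (?m Y)) r s = kron_array d X Y r s" if rs: "r < d * d" "s < d * d" for r s
  proof -
    have d: "0 < d" using rs by (cases d) auto
    have "r div d < d" "s div d < d" using rs by (simp_all add: less_mult_imp_div_less)
    then show ?thesis using rs d by (simp add: kron_def kron_array_def)
  qed
  ultimately show ?thesis using psd_cong[of "d * d" "entries (kron d (?m X) (?m Y))" "kron_array d X Y"] by blast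
qed

lemma pairing_hermitian_real:
  assumes A: "\<And>i j. i < n \<Longrightarrow> j < n \<Longrightarrow> A j i = cnj (A i j)" and B: "\<And>i j. i < n \<Longrightarrow> j < n \<Longrightarrow> B j i = cnj (B i j)"
  shows "Im (pairing n A B) = 0"
proof -
  have "cnj (pairing n A B) = (\<Sum>i<n. \<Sum>j<n. A j i * B i j)"
    unfolding pairing_def cnj_sum
  proof (intro sum.cong refl)
    fix i j assume "i \<in> {..<n}" "j \<in> {..<n}"
    then have "A j i = cnj (A i j)" "B i j = cnj (B j i)" using A[of i j] B[of j i] by simp_all
    then show "cnj (A i j * B j i) = A j i * B i j" by simp
  qed
  also have "\<dots> = pairing n A B" unfolding pairing_def by (rule sum.swap)
  finally show ?thesis by (simp add: complex_eq_iff)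
qed

lemma kron_array_add:
  "kron_array d (X + X') Y = (\<lambda>r s. kron_array d X Y r s + kron_array d X' Y r s)"
  "kron_array d X (Y + Y') = (\<lambda>r s. kron_array d X Y r s + kron_array d X Y' r s)"
  by (simp_all add: kron_array_def algebra_simps)

lemma kron_array_scale:
  "kron_array d (c *\<^sub>R X) Y = (\<lambda>r s. of_real c * kron_array d X Y r s)"
  "kron_array d X (c *\<^sub>R Y) = (\<lambda>r s. of_real c * kron_array d X Y r s)"
  by (simp_all add: kron_array_def scaleR_conv_of_real mult_ac)

lemma pairing_add_left: "pairing n (\<lambda>i j. A i j + A' i j) B = pairing n A B + pairing n A' B"
  by (simp add: pairing_def sum.distrib distrib_right)

lemma dual_product_add:
  "dual_product d \<Lambda> (X + X') Y = dual_product d \<Lambda> X Y + dual_product d \<Lambda> X' Y"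
  "dual_product d \<Lambda> X (Y + Y') = dual_product d \<Lambda> X Y + dual_product d \<Lambda> X Y'"
  by (simp_all add: dual_product_def kron_array_add pairing_add_left fun_eq_iff)

lemma dual_product_scale:
  "dual_product d \<Lambda> (c *\<^sub>R X) Y = c *\<^sub>R dual_product d \<Lambda> X Y"
  "dual_product d \<Lambda> X (c *\<^sub>R Y) = c *\<^sub>R dual_product d \<Lambda> X Y"
  by (simp_all add: dual_product_def kron_array_scale pairing_scale_left fun_eq_iff scaleR_conv_of_real)

text \<open>Expectation of the dual of \<open>X \<otimes> Y\<close> in \<open>v\<close> as a trace
  against the broadcast state; positivity, hermiticity and the marginals are all checked through
  it.\<close>

lemma quad_dual_product:
  assumes "linear_map d (d * d) \<Lambda>"
  shows "quad d (dual_product d \<Lambda> X Y) v = pairing (d * d) (kron_array d X Y) (entries (\<Lambda> (proj d v)))"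
  unfolding quad_dual[OF assms, symmetric] by (intro quad_cong) (auto simp: dual_product_def)

lemma pairing_product_index:
  "pairing (d * d) A B = (\<Sum>i<d. \<Sum>i'<d. \<Sum>p<d. \<Sum>q<d. A (i * d + p) (i' * d + q) * B (i' * d + q) (i * d + p))"
  unfolding pairing_def sum_product_index
  by (rule sum.cong[OF refl], rule sum.swap)

text \<open>The defining property of the partial traces: pairing with \<open>X \<otimes> 1\<close>
  or \<open>1 \<otimes> X\<close> sees one marginal.\<close>

lemma pairing_kron_id:
  "pairing (d * d) (kron_array d X (id_array d)) (entries Y) = pairing d X (entries (ptrace2 d Y))"
  "pairing (d * d) (kron_array d (id_array d) X) (entries Y) = pairing d X (entries (ptrace1 d Y))"
proof -
  have "pairing (d * d) (kron_array d X (id_array d)) (entries Y) =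
      (\<Sum>i<d. \<Sum>i'<d. \<Sum>p<d. \<Sum>q<d. if p = q then X i i' * Y $$ (i' * d + q, i * d + p) else 0)"
    unfolding pairing_product_index
    by (intro sum.cong refl) (auto simp: kron_array_def id_array_def)
  also have "\<dots> = (\<Sum>i<d. \<Sum>i'<d. X i i' * ptrace2 d Y $$ (i', i))"
    by (intro sum.cong refl) (simp add: ptrace2_def sum_distrib_left)
  finally show "pairing (d * d) (kron_array d X (id_array d)) (entries Y) = pairing d X (entries (ptrace2 d Y))"
    by (simp add: pairing_def)
  have "pairing (d * d) (kron_array d (id_array d) X) (entries Y) =
      (\<Sum>i<d. \<Sum>i'<d. if i = i' then \<Sum>p<d. \<Sum>q<d. X p q * Y $$ (i' * d + q, i * d + p) else 0)"
    unfolding pairing_product_index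
    by (rule sum.cong[OF refl], rule sum.cong[OF refl]) (auto simp: kron_array_def id_array_def)
  also have "\<dots> = (\<Sum>i<d. \<Sum>p<d. \<Sum>q<d. X p q * Y $$ (i * d + q, i * d + p))"
    by simp
  also have "\<dots> = (\<Sum>p<d. \<Sum>i<d. \<Sum>q<d. X p q * Y $$ (i * d + q, i * d + p))"
    by (rule sum.swap)
  also have "\<dots> = (\<Sum>p<d. \<Sum>q<d. \<Sum>i<d. X p q * Y $$ (i * d + q, i * d + p))"
    by (rule sum.cong[OF refl], rule sum.swap)
  also have "\<dots> = (\<Sum>p<d. \<Sum>q<d. X p q * ptrace1 d Y $$ (q, p))"
    by (intro sum.cong refl) (simp add: ptrace1_def sum_distrib_left)
  finally show "pairing (d * d) (kron_array d (id_array d) X) (entries Y) = pairing d X (entries (ptrace1 d Y))"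
    by (simp add: pairing_def)
qed

text \<open>Trace preservation of a channel is unitality of its dual.\<close>

lemma dual_product_id_id:
  assumes \<Lambda>: "cptp d (d * d) \<Lambda>"
  shows "dual_product d \<Lambda> (id_array d) (id_array d) = id_array d"
proof (intro ext)
  fix i j
  show "dual_product d \<Lambda> (id_array d) (id_array d) i j = id_array d i j"
  proof (cases "i < d \<and> j < d")
    case True
    have carr: "\<Lambda> (matrix_unit d j i) \<in> carrier_mat (d * d) (d * d)"
      using \<Lambda> matrix_unit_carrier by (simp add: cptp_def completely_positive_def linear_map_def)
    have "dual_product d \<Lambda> (id_array d) (id_array d) i j =
        pairing d (\<lambda>i j. if i = j then 1 else 0) (entries (ptrace2 d (\<Lambda> (matrix_unit d j i))))"
      using True unfolding dual_product_def pairing_kron_id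
      by (auto simp: id_array_def intro!: pairing_cong)
    also have "\<dots> = (\<Sum>a<d. \<Sum>p<d. \<Lambda> (matrix_unit d j i) $$ (a * d + p, a * d + p))"
      unfolding pairing_one by (intro sum.cong refl) (simp add: ptrace2_def)
    also have "\<dots> = mtrace (\<Lambda> (matrix_unit d j i))"
      unfolding mtrace_entries[OF carr] sum_product_index ..
    also have "\<dots> = mtrace (matrix_unit d j i)"
      using \<Lambda> matrix_unit_carrier by (simp add: cptp_def trace_preserving_def)
    also have "\<dots> = (\<Sum>a<d. if a = i then (if i = j then 1 else 0) else 0)"
      unfolding mtrace_entries[OF matrix_unit_carrier] by (intro sum.cong refl) (auto simp: matrix_unit_def)
    also have "\<dots> = id_array d i j" using True by (simp add: id_array_def)
    finally show ?thesis .
  qed (auto simp: dual_product_def id_array_def)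
qed

lemma psd_broadcast:
  assumes "cptp d (d * d) \<Lambda>"
  shows "psd (d * d) (entries (\<Lambda> (proj d v)))"
  using completely_positive_positive[of d "d * d" \<Lambda> "proj d v"] assms proj_positive
  by (simp add: cptp_def positive_op_iff)

lemma dual_product_herm:
  assumes \<Lambda>: "cptp d (d * d) \<Lambda>" and X: "X \<in> herm_arrays d" and Y: "Y \<in> herm_arrays d"
  shows "dual_product d \<Lambda> X Y \<in> herm_arrays d"
proof -
  have lin: "linear_map d (d * d) \<Lambda>" using \<Lambda> by (simp add: cptp_def completely_positive_def)
  have h: "Z j i = cnj (Z i j)" if "Z \<in> herm_arrays d" "i < d" "j < d" for Z i j
    using that by (intro quad_real_imp_hermitian) (auto simp: herm_arrays_def)
  have "Im (quad d (dual_product d \<Lambda> X Y) v) = 0" for v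
    unfolding quad_dual_product[OF lin]
  proof (rule pairing_hermitian_real)
    fix r s assume rs: "r < d * d" "s < d * d"
    then have "r div d < d" "s div d < d" "r mod d < d" "s mod d < d"
      by (auto simp: less_mult_imp_div_less intro!: mod_less_divisor intro: Nat.gr0I)
    then show "kron_array d X Y s r = cnj (kron_array d X Y r s)"
      unfolding kron_array_def complex_cnj_mult using h X Y by metis
    show "\<Lambda> (proj d v) $$ (s, r) = cnj (\<Lambda> (proj d v) $$ (r, s))"
      using psd_hermitian[OF psd_broadcast[OF \<Lambda>] rs] .
  qed
  then show ?thesis by (auto simp: herm_arrays_def dual_product_def)
qed

lemma positive_bilinear_sym_product:
  assumes d: "0 < d" and \<Lambda>: "cptp d (d * d) \<Lambda>"
  shows "positive_bilinear (herm_arrays d) (array_basis d) (vector_states d) (id_array d) (sym_product d \<Lambda>)"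
proof (rule positive_bilinear.intro)
  have lin: "linear_map d (d * d) \<Lambda>" using \<Lambda> by (simp add: cptp_def completely_positive_def)
  show "subspace (herm_arrays d)" by (rule subspace_herm_arrays)
  show "finite (array_basis d)" by (simp add: array_basis_def)
  show "herm_arrays d \<subseteq> span (array_basis d)" by (rule herm_arrays_span)
  show "id_array d \<in> herm_arrays d"
    by (simp add: herm_arrays_def quad_id_array) (simp add: id_array_def)
  show "linear \<phi>" if "\<phi> \<in> vector_states d" for \<phi>
    using that by (auto simp: vector_states_def quad_plus quad_scaleR intro!: linearI)
  show "\<phi> (id_array d) = 1" if "\<phi> \<in> vector_states d" for \<phi>
    using that by (auto simp: vector_states_def quad_id_array)
  show "\<exists>c. \<forall>\<phi>\<in>vector_states d. \<bar>\<phi> X\<bar> \<le> c" for X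
    using quad_bounded[of d _ X] abs_Re_le_cmod order_trans
    by (intro exI[of _ "\<Sum>i<d. \<Sum>j<d. cmod (X i j)"]) (fastforce simp: vector_states_def)
  show "X = 0" if X: "X \<in> herm_arrays d" and z: "\<And>\<phi>. \<phi> \<in> vector_states d \<Longrightarrow> \<phi> X = 0" for X
  proof (rule array_eq_if_unit[OF d])
    fix w assume "norm2 d w = 1"
    then have "Re (quad d X w) = 0" using z[of "\<lambda>X. Re (quad d X w)"] by (auto simp: vector_states_def)
    moreover have "Im (quad d X w) = 0" using X by (simp add: herm_arrays_def)
    ultimately show "quad d X w = quad d 0 w" by (simp add: complex_eq_iff quad_def)
  qed (use X in \<open>simp add: herm_arrays_def\<close>)
  show "sym_product d \<Lambda> X Y \<in> herm_arrays d" if "X \<in> herm_arrays d" "Y \<in> herm_arrays d" for X Y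
    unfolding sym_product_def using that dual_product_herm[OF \<Lambda>]
    by (intro subspace_scale subspace_add subspace_herm_arrays)
  show "linear (sym_product d \<Lambda> X)" "linear (\<lambda>X. sym_product d \<Lambda> X Y)" for X Y
    by (auto intro!: linearI simp: sym_product_def dual_product_add dual_product_scale scaleR_add_right)
  show "sym_product d \<Lambda> (id_array d) X = sym_product d \<Lambda> X (id_array d)" for X
    by (simp add: sym_product_def add.commute)
  show "sym_product d \<Lambda> (id_array d) (id_array d) = id_array d"
    unfolding sym_product_def dual_product_id_id[OF \<Lambda>] by (simp flip: scaleR_2)
  fix X Y \<phi>
  assume X: "X \<in> herm_arrays d" "\<And>\<psi>. \<psi> \<in> vector_states d \<Longrightarrow> 0 \<le> \<psi> X"
    and Y: "Y \<in> herm_arrays d" "\<And>\<psi>. \<psi> \<in> vector_states d \<Longrightarrow> 0 \<le> \<psi> Y"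
    and \<phi>: "\<phi> \<in> vector_states d"
  obtain v where v: "\<phi> = (\<lambda>X. Re (quad d X v))" using \<phi> by (auto simp: vector_states_def)
  have psd: "psd d X" "psd d Y" using psd_if_vector_states_nonneg[OF d] X Y by auto
  have "0 \<le> pairing (d * d) (kron_array d X Y) (entries (\<Lambda> (proj d v)))"
    "0 \<le> pairing (d * d) (kron_array d Y X) (entries (\<Lambda> (proj d v)))"
    using psd by (auto intro!: pairing_nonneg psd_kron_array psd_broadcast[OF \<Lambda>])
  then show "0 \<le> \<phi> (sym_product d \<Lambda> X Y)"
    unfolding v sym_product_def quad_scaleR quad_plus quad_dual_product[OF lin]
    by (simp add: less_eq_complex_def)
qed

section \<open>Fixed effects and the sharp observable\<close>

definition to_array :: "nat \<Rightarrow> complex mat \<Rightarrow> nat \<Rightarrow> nat \<Rightarrow> complex" where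
  "to_array d A = (\<lambda>i j. if i < d \<and> j < d then A $$ (i, j) else 0)"

lemma quad_to_array: "quad d (to_array d A) v = quad d (entries A) v"
  by (intro quad_cong) (auto simp: to_array_def)

lemma pairing_to_array: "pairing d (to_array d A) B = pairing d (entries A) B"
  by (intro pairing_cong) (auto simp: to_array_def)

text \<open>The two broadcasting conditions fix both halves of the symmetrised product,
  \<open>A \<otimes> 1\<close> through \<open>ptrace2\<close> and \<open>1 \<otimes> A\<close>
  through \<open>ptrace1\<close>; pure states suffice to test it.\<close>

lemma sym_product_fixes_broadcast:
  assumes d: "0 < d" and \<Lambda>: "cptp d (d * d) \<Lambda>" and A: "A \<in> carrier_mat d d"
    and b2: "\<And>\<rho>. \<rho> \<in> states d \<Longrightarrow> mtrace (A * ptrace2 d (\<Lambda> \<rho>)) = mtrace (A * \<rho>)"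
    and b1: "\<And>\<rho>. \<rho> \<in> states d \<Longrightarrow> mtrace (A * ptrace1 d (\<Lambda> \<rho>)) = mtrace (A * \<rho>)"
  shows "sym_product d \<Lambda> (to_array d A) (id_array d) = to_array d A"
proof (rule array_eq_if_unit[OF d])
  have lin: "linear_map d (d * d) \<Lambda>" using \<Lambda> by (simp add: cptp_def completely_positive_def)
  fix w assume w: "norm2 d w = 1"
  have pt: "ptrace1 d Y \<in> carrier_mat d d" "ptrace2 d Y \<in> carrier_mat d d" for Y
    by (simp_all add: ptrace1_def ptrace2_def)
  have "quad d (dual_product d \<Lambda> (to_array d A) (id_array d)) w = mtrace (A * ptrace2 d (\<Lambda> (proj d w)))"
    unfolding quad_dual_product[OF lin] pairing_kron_id mtrace_mult[OF A pt(2)] pairing_to_array ..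
  also have "\<dots> = quad d (to_array d A) w"
    using b2[OF proj_state[OF w]] by (simp add: mtrace_mult_proj[OF A] quad_to_array)
  finally have 2: "quad d (dual_product d \<Lambda> (to_array d A) (id_array d)) w = quad d (to_array d A) w" .
  have "quad d (dual_product d \<Lambda> (id_array d) (to_array d A)) w = mtrace (A * ptrace1 d (\<Lambda> (proj d w)))"
    unfolding quad_dual_product[OF lin] pairing_kron_id mtrace_mult[OF A pt(1)] pairing_to_array ..
  also have "\<dots> = quad d (to_array d A) w"
    using b1[OF proj_state[OF w]] by (simp add: mtrace_mult_proj[OF A] quad_to_array)
  finally show "quad d (sym_product d \<Lambda> (to_array d A) (id_array d)) w = quad d (to_array d A) w"
    using 2 by (simp add: sym_product_def quad_scaleR quad_plus)
qed (auto simp: sym_product_def dual_product_def to_array_def)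

lemma to_array_herm: "positive_op d A \<Longrightarrow> to_array d A \<in> herm_arrays d"
  by (auto simp: herm_arrays_def quad_to_array positive_op_iff psd_def less_eq_complex_def)
    (auto simp: to_array_def)

text \<open>The dual basis of the fixed space is the POVM, and \<open>p(k|l)\<close> is the value of
  the state \<open>\<omega>_l\<close> on \<open>A_k\<close>: positive as \<open>A_k\<close> is, and
  summing to \<open>\<omega>_l(1) = 1\<close>.\<close>

lemma sharp_povm_if_broadcastable:
  assumes d: "0 < d" and \<A>: "\<forall>A\<in>\<A>. povm d A" and br: "broadcastable d (states d) \<A> \<A>"
  shows "\<exists>G. povm d G \<and> (\<forall>l<length G. op_norm d (G ! l) = 1) \<and> (\<forall>A\<in>\<A>. post_processing d A G)"
proof -
  obtain \<Lambda> where \<Lambda>: "cptp d (d * d) \<Lambda>"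
    and b2: "\<And>A k \<rho>. A \<in> \<A> \<Longrightarrow> k < length A \<Longrightarrow> \<rho> \<in> states d \<Longrightarrow>
      mtrace (A ! k * ptrace2 d (\<Lambda> \<rho>)) = mtrace (A ! k * \<rho>)"
    and b1: "\<And>A k \<rho>. A \<in> \<A> \<Longrightarrow> k < length A \<Longrightarrow> \<rho> \<in> states d \<Longrightarrow>
      mtrace (A ! k * ptrace1 d (\<Lambda> \<rho>)) = mtrace (A ! k * \<rho>)"
    using br unfolding broadcastable_def by metis
  interpret PB: positive_bilinear "herm_arrays d" "array_basis d" "vector_states d" "id_array d" "sym_product d \<Lambda>"
    by (rule positive_bilinear_sym_product[OF d \<Lambda>])
  have "vector_states d \<noteq> {}"
    using unit_vector_reduction[OF d] by (auto simp: vector_states_def)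
  from PB.fixed_points_classical[OF this] obtain D g where fin: "finite D" and DK: "D \<subseteq> PB.K"
    and g: "\<And>\<omega>. \<omega> \<in> D \<Longrightarrow> g \<omega> \<in> PB.F" "\<And>\<omega>. \<omega> \<in> D \<Longrightarrow> PB.pos (g \<omega>)" "\<And>\<omega>. \<omega> \<in> D \<Longrightarrow> \<omega> (g \<omega>) = 1"
    and dec: "\<And>X. X \<in> PB.F \<Longrightarrow> X = (\<Sum>\<omega>\<in>D. \<omega> X *\<^sub>R g \<omega>)"
    by blast
  obtain ws where ws: "set ws = D" "distinct ws"
    using finite_distinct_list[OF fin] by blast
  have wsD: "ws ! l \<in> D" if "l < length ws" for l using that ws(1) nth_mem by blast
  have wsK: "ws ! l \<in> PB.K" if "l < length ws" for l using wsD[OF that] DK by blast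
  have dec_entry: "X i j = (\<Sum>l<length ws. of_real ((ws ! l) X) * g (ws ! l) i j)" if X: "X \<in> PB.F" for X i j
  proof -
    have "X i j = (\<Sum>\<omega>\<in>D. \<omega> X *\<^sub>R g \<omega>) i j" using dec[OF X] by simp
    also have "\<dots> = (\<Sum>\<omega>\<in>D. of_real (\<omega> X) * g \<omega> i j)"
      by (simp add: sum_fun_apply2 scaleR_conv_of_real)
    also have "\<dots> = (\<Sum>l<length ws. of_real ((ws ! l) X) * g (ws ! l) i j)"
      using sum.reindex_bij_betw[OF bij_betw_nth[OF ws(2) refl ws(1)[symmetric]], symmetric] .
    finally show ?thesis .
  qed
  define G where "G = map (\<lambda>\<omega>. mat d d (\<lambda>(i, j). g \<omega> i j)) ws"
  have len: "length G = length ws" by (simp add: G_def)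
  have Gij: "G ! l $$ (i, j) = g (ws ! l) i j" if "l < length ws" "i < d" "j < d" for l i j
    using that by (simp add: G_def)
  have Gquad: "quad d (entries (G ! l)) v = quad d (g (ws ! l)) v" if "l < length ws" for l v
    using Gij[OF that] by (intro quad_cong) auto
  have gpsd: "psd d (g (ws ! l))" if "l < length ws" for l
    using psd_if_vector_states_nonneg[OF d] g(1,2)[OF wsD[OF that]] by (auto simp: PB.pos_def dest: PB.F_W)
  have Gpos: "positive_op d (G ! l)" if "l < length ws" for l
    using gpsd[OF that] Gquad[OF that] that by (auto simp: positive_op_iff psd_def G_def)
  have povm: "povm d G"
  proof -
    have "msum d (\<lambda>k. G ! k) {..<length G} = 1\<^sub>m d"
    proof (rule eq_matI)
      fix i j assume "i < dim_row (1\<^sub>m d)" "j < dim_col (1\<^sub>m d)"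
      then have ij: "i < d" "j < d" by auto
      \<comment> \<open>Normalisation is the expansion of the unit, all of whose coefficients are
        \<open>\<omega>(1) = 1\<close>.\<close>
      have "(\<Sum>l<length ws. g (ws ! l) i j) = id_array d i j"
        using dec_entry[OF PB.u_F, of i j] PB.K_D(4)[OF wsK] by simp
      then show "msum d (\<lambda>k. G ! k) {..<length G} $$ (i, j) = 1\<^sub>m d $$ (i, j)"
        using ij by (simp add: msum_def len Gij id_array_def)
    qed (auto simp: msum_def)
    then show ?thesis using Gpos by (simp add: povm_def len)
  qed
  have norm: "op_norm d (G ! l) = 1" if l: "l < length ws" for l
  proof -
    let ?c = "op_norm d (G ! l)" and ?\<omega> = "ws ! l"
    obtain \<psi> where \<psi>: "norm2 d \<psi> = 1" "quad d (entries (G ! l)) \<psi> = of_real ?c"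
      and le: "\<And>v. Re (quad d (entries (G ! l)) v) \<le> ?c * norm2 d v"
      using op_norm_attained[OF d Gpos[OF l]] by blast
    have "0 \<le> quad d (entries (G ! k)) \<psi>" if "k < length G" for k
      using povm_length(1)[OF povm that] by (simp add: positive_op_iff psd_def)
    then have "Re (quad d (entries (G ! l)) \<psi>) \<le> (\<Sum>k<length G. Re (quad d (entries (G ! k)) \<psi>))"
      using l len by (intro member_le_sum) (auto simp: less_eq_complex_def)
    then have le1: "?c \<le> 1"
      unfolding Re_sum[symmetric] povm_quad_sum[OF povm] using \<psi> by simp
    have gF: "g ?\<omega> \<in> PB.F" using g(1)[OF wsD[OF l]] .
    have cu: "?c *\<^sub>R id_array d \<in> PB.F" using PB.subspace_F PB.u_F by (rule subspace_scale)
    \<comment> \<open>Evaluating \<open>\<omega>\<close> on this positive element gives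
      \<open>c - 1 \<ge> 0\<close>, the lower bound on the norm.\<close>
    have "PB.pos (?c *\<^sub>R id_array d - g ?\<omega>)"
      unfolding PB.pos_def
    proof
      fix \<phi> assume "\<phi> \<in> vector_states d"
      then obtain v where v: "\<phi> = (\<lambda>X. Re (quad d X v))" "norm2 d v = 1" by (auto simp: vector_states_def)
      then show "0 \<le> \<phi> (?c *\<^sub>R id_array d - g ?\<omega>)"
        using le[of v] by (simp add: quad_minus quad_scaleR quad_id_array Gquad[OF l])
    qed
    then have "0 \<le> ?\<omega> (?c *\<^sub>R id_array d - g ?\<omega>)"
      by (rule PB.K_D(5)[OF wsK[OF l] subspace_diff[OF PB.subspace_F cu gF]])
    then have "1 \<le> ?c"
      using PB.K_diff[OF wsK[OF l] cu gF] PB.K_D(3,4)[OF wsK[OF l]] PB.u_F g(3)[OF wsD[OF l]] by simp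
    with le1 show ?thesis by simp
  qed
  have pp: "post_processing d A G" if A: "A \<in> \<A>" for A
  proof -
    have povmA: "povm d A" using \<A> A by blast
    have pos: "positive_op d (A ! k)" if "k < length A" for k using povm_length(1)[OF povmA that] .
    have F: "to_array d (A ! k) \<in> PB.F" if "k < length A" for k
    proof -
      have "sym_product d \<Lambda> (to_array d (A ! k)) (id_array d) = to_array d (A ! k)"
        using sym_product_fixes_broadcast[OF d \<Lambda> positive_carrier[OF pos[OF that]]] b1 b2 A that by blast
      then show ?thesis using to_array_herm[OF pos[OF that]] by (simp add: PB.F_def PB.T_def)
    qed
    define p where "p k l = (ws ! l) (to_array d (A ! k))" for k l
    have "0 \<le> p k l" if "k < length A" "l < length ws" for k l
      unfolding p_def
    proof (rule PB.K_D(5)[OF wsK[OF that(2)] F[OF that(1)]])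
      show "PB.pos (to_array d (A ! k))"
        using pos[OF that(1)] unfolding PB.pos_def
        by (auto simp: vector_states_def quad_to_array positive_op_iff psd_def less_eq_complex_def)
    qed
    moreover have "(\<Sum>k<length A. p k l) = 1" if "l < length ws" for l
    proof -
      have "(\<Sum>k<length A. to_array d (A ! k)) = id_array d"
      proof (intro ext)
        fix i j
        show "(\<Sum>k<length A. to_array d (A ! k)) i j = id_array d i j"
          using povm_length(2)[OF povmA, of i j]
          by (cases "i < d \<and> j < d") (auto simp: sum_fun_apply2 to_array_def id_array_def)
      qed
      moreover have "(ws ! l) (\<Sum>k<length A. to_array d (A ! k)) = (\<Sum>k<length A. p k l)"
        unfolding p_def by (rule PB.K_sum[OF wsK[OF that]]) (simp add: F)
      ultimately show ?thesis using PB.K_D(4)[OF wsK[OF that]] by simp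
    qed
    moreover have "A ! k = msum d (\<lambda>l. complex_of_real (p k l) \<cdot>\<^sub>m G ! l) {..<length G}" if k: "k < length A" for k
    proof (rule eq_matI)
      fix i j assume "i < dim_row (msum d (\<lambda>l. complex_of_real (p k l) \<cdot>\<^sub>m G ! l) {..<length G})"
        "j < dim_col (msum d (\<lambda>l. complex_of_real (p k l) \<cdot>\<^sub>m G ! l) {..<length G})"
      then have ij: "i < d" "j < d" by (auto simp: msum_def)
      have "(complex_of_real (p k l) \<cdot>\<^sub>m G ! l) $$ (i, j) = p k l * g (ws ! l) i j" if "l < length ws" for l
        using positive_carrier[OF Gpos[OF that]] ij Gij[OF that ij] by simp
      then show "A ! k $$ (i, j) = msum d (\<lambda>l. complex_of_real (p k l) \<cdot>\<^sub>m G ! l) {..<length G} $$ (i, j)"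
        using ij dec_entry[OF F[OF k], of i j] by (simp add: msum_def len p_def to_array_def)
    qed (use positive_carrier[OF pos[OF k]] in \<open>auto simp: msum_def\<close>)
    ultimately show ?thesis
      unfolding post_processing_def by (intro exI[of _ p]) (simp add: len)
  qed
  show ?thesis using povm norm pp len by (intro exI[of _ G]) simp
qed

theorem theorem2:
  fixes d :: nat and \<A> :: "complex mat list set"
  assumes "0 < d"
    and "\<forall>A\<in>\<A>. povm d A"
  shows "(no_contextuality_proof d \<A> \<longleftrightarrow> broadcastable d (states d) \<A> \<A>) \<and>
         (broadcastable d (states d) \<A> \<A> \<longleftrightarrow>
            (\<exists>G. povm d G \<and> (\<forall>l<length G. op_norm d (G ! l) = 1) \<and>
                 (\<forall>A\<in>\<A>. post_processing d A G))) \<and>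
         ((\<exists>G. povm d G \<and> (\<forall>l<length G. op_norm d (G ! l) = 1) \<and>
                 (\<forall>A\<in>\<A>. post_processing d A G)) \<longleftrightarrow>
            (\<exists>G. povm d G \<and> repeatable d G \<and> (\<forall>A\<in>\<A>. post_processing d A G)))"
proof -
  let ?sharp = "\<exists>G. povm d G \<and> (\<forall>l<length G. op_norm d (G ! l) = 1) \<and> (\<forall>A\<in>\<A>. post_processing d A G)"
  let ?rep = "\<exists>G. povm d G \<and> repeatable d G \<and> (\<forall>A\<in>\<A>. post_processing d A G)"
  have "no_contextuality_proof d \<A> \<Longrightarrow> broadcastable d (states d) \<A> \<A>"
    by (rule broadcastable_if_noncontextual[OF assms])
  moreover have "broadcastable d (states d) \<A> \<A> \<Longrightarrow> ?sharp"
    by (rule sharp_povm_if_broadcastable[OF assms])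
  moreover have "?sharp \<Longrightarrow> ?rep"
    using repeatable_if_op_norm_1[OF assms(1)] by metis
  moreover have "?rep \<Longrightarrow> no_contextuality_proof d \<A>"
    using noncontextual_if_repeatable[OF assms(1)] by metis
  ultimately show ?thesis by argo
qed

end
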